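(* Let $\mathcal V$ and $\mathcal V^n$ be the variance processes given by $$d\mathcal V(t)=\mathfrak C\mathcal V(t)\,dt+d\mathcal L(t),\ \ \mathcal V(0)=\mathcal V_0,\qquad d\mathcal V^n(t)=\mathfrak C^n\mathcal V^n(t)\,dt+d\mathcal L^n(t),\ \ \mathcal V^n(0)=\mathcal V^n_0,$$ and suppose that $\mathcal V(t)$ and $\mathcal V^n(t)$ are non-negative definite and trace class. Then for every $T>0$, $$\mathbb E\Big[\sup_{0\le t\le T}\big\|\sqrt{\mathcal V(t)}-\sqrt{\mathcal V^n(t)}\big\|_{\mathcal H}^2\Big]\le\mathbb E\Big[\sup_{0\le t\le T}\|\mathcal V(t)-\mathcal V^n(t)\|_1\Big].$$
   Context: $H$ is a separable real Hilbert space and $\mathcal H=L_{HS}(H)$ is the Hilbert space of Hilbert-Schmidt operators on $H$ with norm $\|\cdot\|_{\mathcal H}$. Trace class operators on $H$ are the compact operators with finite trace norm $\|\mathcal T\|_1:=\|(\mathcal T^*\mathcal T)^{1/4}\|_{\mathcal H}^2$. $\mathfrak C,\mathfrak C^n\in L(\mathcal H)$ are bounded operators, $\mathcal V_0,\mathcal V_0^n$ are $\mathcal H$-valued initial values, and $\mathcal L(t)=\sum_{i=1}^{N(t)}\mathcal X_i$, $\mathcal L^n(t)=\sum_{i=1}^{N(t)}\mathcal X_i^n$ are $\mathcal H$-valued compound Poisson processes driven by the same Poisson process $N$ of intensity $\lambda>0$. The solution is $\mathcal V(t)=e^{\mathfrak Ct}\mathcal V_0+\int_0^te^{\mathfrak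 C(t-s)}d\mathcal L(s)$; similarly for $\mathcal V^n$. "Non-negative definite" operators are self-adjoint, and $\sqrt A$ denotes the unique non-negative definite operator with $\sqrt A\sqrt A=A$. *)

theory Defs
  imports "HOL-Probability.Probability"
begin

section \<open>Orthonormal bases\<close>

definition orthonormal :: "'a::real_inner set \<Rightarrow> bool" where
  "orthonormal B \<longleftrightarrow> (\<forall>e\<in>B. norm e = 1) \<and> pairwise orthogonal B"

definition orthonormal_basis :: "'a::real_inner set \<Rightarrow> bool" where
  "orthonormal_basis B \<longleftrightarrow> orthonormal B \<and> closure (span B) = UNIV"

lemma orthonormal_inner:
  assumes "orthonormal B" "e \<in> B" "f \<in> B"
  shows "e \<bullet> f = (if e = f then 1 else 0)"
proof (cases "e = f")
  case True
  then show ?thesis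
    using assms by (simp add: orthonormal_def norm_eq_1)
next
  case False
  then show ?thesis
    using assms by (simp add: orthonormal_def pairwise_def orthogonal_def)
qed

lemma orthonormal_inner_sum:
  assumes "orthonormal B" "finite F" "F \<subseteq> B" "f \<in> F"
  shows "(\<Sum>e\<in>F. c e *\<^sub>R e) \<bullet> f = c f"
proof -
  have "(\<Sum>e\<in>F. c e *\<^sub>R e) \<bullet> f = (\<Sum>e\<in>F. if e = f then c e else 0)"
    unfolding inner_sum_left
    by (rule sum.cong) (use assms in \<open>auto simp: orthonormal_inner[OF assms(1)] subset_iff\<close>)
  then show ?thesis
    using assms by simp
qed

lemma orthonormal_norm_sum:
  assumes "orthonormal B" "finite F" "F \<subseteq> B"
  shows "(norm (\<Sum>e\<in>F. c e *\<^sub>R e))\<^sup>2 = (\<Sum>e\<in>F. (c e)\<^sup>2)"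
proof -
  have "(norm (\<Sum>e\<in>F. c e *\<^sub>R e))\<^sup>2 = (\<Sum>f\<in>F. c f * ((\<Sum>e\<in>F. c e *\<^sub>R e) \<bullet> f))"
    unfolding power2_norm_eq_inner by (subst inner_sum_right) simp
  also have "\<dots> = (\<Sum>f\<in>F. (c f)\<^sup>2)"
    by (rule sum.cong) (auto simp: orthonormal_inner_sum[OF assms] power2_eq_square)
  finally show ?thesis .
qed

lemma bessel_finite:
  assumes "orthonormal B" "finite F" "F \<subseteq> B"
  shows "(\<Sum>e\<in>F. (x \<bullet> e)\<^sup>2) \<le> (norm x)\<^sup>2"
proof -
  let ?s = "\<Sum>e\<in>F. (x \<bullet> e) *\<^sub>R e"
  have xs: "x \<bullet> ?s = (\<Sum>e\<in>F. (x \<bullet> e)\<^sup>2)"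
    by (simp add: inner_sum_right power2_eq_square)
  have ss: "?s \<bullet> ?s = (\<Sum>e\<in>F. (x \<bullet> e)\<^sup>2)"
    using orthonormal_norm_sum[OF assms, of "\<lambda>e. x \<bullet> e"] by (simp add: power2_norm_eq_inner)
  have "0 \<le> (x - ?s) \<bullet> (x - ?s)"
    by (rule inner_ge_zero)
  also have "\<dots> = x \<bullet> x - 2 * (x \<bullet> ?s) + ?s \<bullet> ?s"
    by (simp add: inner_diff inner_commute[of ?s x])
  also have "\<dots> = (norm x)\<^sup>2 - (\<Sum>e\<in>F. (x \<bullet> e)\<^sup>2)"
    unfolding xs ss by (simp add: power2_norm_eq_inner)
  finally show ?thesis by simp
qed

lemma bessel_summable:
  assumes "orthonormal B"
  shows "(\<lambda>e. (x \<bullet> e)\<^sup>2) summable_on B"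
proof (rule nonneg_bdd_above_summable_on)
  show "bdd_above (sum (\<lambda>e. (x \<bullet> e)\<^sup>2) ` {F. F \<subseteq> B \<and> finite F})"
    by (rule bdd_aboveI[of _ "(norm x)\<^sup>2"]) (use bessel_finite[OF assms] in auto)
qed auto

lemma orthonormal_summable:
  fixes B :: "'a::{real_inner,banach} set"
  assumes B: "orthonormal B" and c: "(\<lambda>e. (c e)\<^sup>2) summable_on B"
  shows "(\<lambda>e. c e *\<^sub>R e) summable_on B"
proof -
  let ?S = "sum (\<lambda>e. c e *\<^sub>R e)" and ?F = "finite_subsets_at_top B"
  have "\<exists>P. eventually P ?F \<and> (\<forall>F F'. P F \<and> P F' \<longrightarrow> dist (?S F) (?S F') < \<epsilon>)"
    if "\<epsilon> > 0" for \<epsilon> :: real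
  proof -
    define d where "d = (\<epsilon> / 2)\<^sup>2"
    have "d > 0" using that by (simp add: d_def)
    obtain F0 where F0: "finite F0" "F0 \<subseteq> B"
        "dist (\<Sum>e\<in>F0. (c e)\<^sup>2) (infsum (\<lambda>e. (c e)\<^sup>2) B) \<le> d / 2"
      using infsum_finite_approximation[OF c, of "d / 2"] \<open>d > 0\<close> by auto
    have near: "dist (?S F) (?S F0) < \<epsilon> / 2" if F: "finite F" "F \<subseteq> B" "F0 \<subseteq> F" for F
    proof -
      have "(\<Sum>e\<in>F. (c e)\<^sup>2) \<le> infsum (\<lambda>e. (c e)\<^sup>2) B"
        by (rule finite_sum_le_infsum) (use c F in auto)
      then have "(\<Sum>e\<in>F - F0. (c e)\<^sup>2) \<le> d / 2"
        using F0(3) sum_diff[OF F(1,3), of "\<lambda>e. (c e)\<^sup>2"] by (simp only: dist_real_def abs_le_iff) linarith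
      moreover have "(norm (?S (F - F0)))\<^sup>2 = (\<Sum>e\<in>F - F0. (c e)\<^sup>2)"
        by (rule orthonormal_norm_sum[OF B]) (use F in auto)
      ultimately have "(norm (?S (F - F0)))\<^sup>2 < (\<epsilon> / 2)\<^sup>2"
        using \<open>d > 0\<close> unfolding d_def by linarith
      then have "norm (?S (F - F0)) < \<epsilon> / 2"
        using \<open>\<epsilon> > 0\<close> by (meson less_eq_real_def half_gt_zero power_less_imp_less_base)
      then show ?thesis
        using F F0 by (simp add: dist_norm sum_diff)
    qed
    define P where "P F \<longleftrightarrow> finite F \<and> F \<subseteq> B \<and> F0 \<subseteq> F" for F
    have "eventually P ?F"
      unfolding eventually_finite_subsets_at_top P_def using F0 by blast
    moreover have "dist (?S F) (?S F') < \<epsilon>" if "P F" "P F'" for F F'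
      using near[of F] near[of F'] that dist_triangle2[of "?S F" "?S F'" "?S F0"]
      by (auto simp: P_def)
    ultimately show ?thesis by blast
  qed
  then have "cauchy_filter (filtermap ?S ?F)"
    by (simp add: cauchy_filter_metric_filtermap)
  moreover have "Topological_Spaces.complete (UNIV :: 'a set)"
    by (rule complete_UNIV)
  ultimately obtain L where "(?S \<longlongrightarrow> L) ?F"
    using complete_uniform[where S=UNIV] by (force simp add: filterlim_def)
  then show ?thesis
    using summable_on_def has_sum_def by blast
qed

lemma orthonormal_residual:
  fixes B :: "'a::{real_inner,banach} set"
  assumes "orthonormal B" "f \<in> B"
  shows "(x - (\<Sum>\<^sub>\<infinity>e\<in>B. (x \<bullet> e) *\<^sub>R e)) \<bullet> f = 0"
proof -
  have "(\<lambda>e. (x \<bullet> e) *\<^sub>R e) summable_on B"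
    by (intro orthonormal_summable bessel_summable assms)
  then have "((\<lambda>e. (x \<bullet> e) *\<^sub>R e) has_sum (\<Sum>\<^sub>\<infinity>e\<in>B. (x \<bullet> e) *\<^sub>R e)) B"
    by (rule has_sum_infsum)
  from has_sum_bounded_linear[OF bounded_linear_inner_left[of f] this]
  have "((\<lambda>e. (x \<bullet> e) * (e \<bullet> f)) has_sum (\<Sum>\<^sub>\<infinity>e\<in>B. (x \<bullet> e) *\<^sub>R e) \<bullet> f) B"
    by simp
  moreover have "((\<lambda>e. (x \<bullet> e) * (e \<bullet> f)) has_sum (x \<bullet> f)) B"
  proof -
    have "((\<lambda>e. (x \<bullet> e) * (e \<bullet> f)) has_sum (\<Sum>e\<in>{f}. (x \<bullet> e) * (e \<bullet> f))) {f}"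
      by (rule has_sum_finiteI) auto
    also have "(\<Sum>e\<in>{f}. (x \<bullet> e) * (e \<bullet> f)) = x \<bullet> f"
      using assms by (simp add: orthonormal_inner)
    also have "((\<lambda>e. (x \<bullet> e) * (e \<bullet> f)) has_sum (x \<bullet> f)) {f} \<longleftrightarrow> ?thesis"
      by (rule has_sum_cong_neutral)
        (use assms in \<open>auto simp: orthonormal_inner[OF assms(1)] subset_iff\<close>)
    finally show ?thesis .
  qed
  ultimately show ?thesis
    using has_sum_unique by (fastforce simp: inner_diff_left)
qed

lemma orthonormal_basis_exists:
  "\<exists>B :: 'a::{real_inner,banach} set. orthonormal_basis B"
proof -
  have "\<exists>M\<in>{B::'a set. orthonormal B}. \<forall>X\<in>{B. orthonormal B}. M \<subseteq> X \<longrightarrow> X = M"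
  proof (rule subset_Zorn')
    fix C :: "'a set set" assume C: "subset.chain {B. orthonormal B} C"
    have 1: "orthonormal B" if "B \<in> C" for B
      using C that by (auto simp: subset.chain_def)
    have "orthogonal x y" if xy: "x \<in> \<Union>C" "y \<in> \<Union>C" "x \<noteq> y" for x y
    proof -
      obtain A B where AB: "A \<in> C" "x \<in> A" "B \<in> C" "y \<in> B" using xy by auto
      then have "A \<subseteq> B \<or> B \<subseteq> A"
        using C by (auto simp: subset_chain_def)
      then show ?thesis
        using AB 1[of A] 1[of B] xy(3) by (auto simp: orthonormal_def pairwise_def)
    qed
    then show "\<Union>C \<in> {B. orthonormal B}"
      using 1 by (auto simp: orthonormal_def pairwise_def)
  qed
  then obtain M :: "'a set" where M: "orthonormal M" and max: "\<And>X. orthonormal X \<Longrightarrow> M \<subseteq> X \<Longrightarrow> X = M"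
    by auto
  have "x \<in> closure (span M)" for x
  proof -
    define s where "s = (\<Sum>\<^sub>\<infinity>e\<in>M. (x \<bullet> e) *\<^sub>R e)"
    have orth: "(x - s) \<bullet> f = 0" if "f \<in> M" for f
      unfolding s_def by (rule orthonormal_residual[OF M that])
    have "x = s"
    proof (rule ccontr)
      assume "x \<noteq> s"
      define u where "u = (x - s) /\<^sub>R norm (x - s)"
      have "norm u = 1" using \<open>x \<noteq> s\<close> by (simp add: u_def)
      have "orthogonal u f \<and> orthogonal f u" if "f \<in> M" for f
        using orth[OF that] by (simp add: u_def orthogonal_def inner_commute)
      then have "orthonormal (insert u M)"
        using M \<open>norm u = 1\<close> by (auto simp: orthonormal_def pairwise_insert)
      from max[OF this] have "u \<in> M" by auto
      from orth[OF this] \<open>x \<noteq> s\<close> show False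
        by (simp add: u_def)
    qed
    have "(\<lambda>e. (x \<bullet> e) *\<^sub>R e) summable_on M"
      by (intro orthonormal_summable bessel_summable M)
    then have lim: "(sum (\<lambda>e. (x \<bullet> e) *\<^sub>R e) \<longlongrightarrow> s) (finite_subsets_at_top M)"
      unfolding s_def by (rule infsum_tendsto)
    have "s \<in> closure (span M)"
    proof (rule Lim_in_closed_set[OF closed_closure _ finite_subsets_at_top_neq_bot lim])
      show "\<forall>\<^sub>F F in finite_subsets_at_top M. (\<Sum>e\<in>F. (x \<bullet> e) *\<^sub>R e) \<in> closure (span M)"
        by (rule eventually_finite_subsets_at_top_weakI)
          (intro closure_subset[THEN subsetD] span_sum span_scale span_base, auto)
    qed
    with \<open>x = s\<close> show ?thesis by simp
  qed
  then show ?thesis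
    using M unfolding orthonormal_basis_def by blast
qed

definition onb :: "'a::{real_inner,banach} set" where
  "onb = (SOME B. orthonormal_basis B)"

lemma orthonormal_basis_onb: "orthonormal_basis onb"
  unfolding onb_def using orthonormal_basis_exists by (rule someI_ex)

lemma orthonormal_onb: "orthonormal onb"
  using orthonormal_basis_onb orthonormal_basis_def by blast

lemma fourier_expansion:
  fixes B :: "'a::{real_inner,banach} set"
  assumes "orthonormal_basis B"
  shows "((\<lambda>e. (x \<bullet> e) *\<^sub>R e) has_sum x) B"
proof -
  have B: "orthonormal B" using assms by (simp add: orthonormal_basis_def)
  define s where "s = (\<Sum>\<^sub>\<infinity>e\<in>B. (x \<bullet> e) *\<^sub>R e)"
  have "span B \<subseteq> {y. (x - s) \<bullet> y = 0}"
    by (rule span_minimal) (use orthonormal_residual[OF B] in \<open>auto simp: s_def subspace_hyperplane\<close>)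
  then have "closure (span B) \<subseteq> {y. (x - s) \<bullet> y = 0}"
    by (rule closure_minimal) (rule closed_hyperplane)
  then have "(x - s) \<bullet> (x - s) = 0"
    using assms unfolding orthonormal_basis_def by blast
  then have "x = s" by simp
  moreover have "(\<lambda>e. (x \<bullet> e) *\<^sub>R e) summable_on B"
    by (intro orthonormal_summable bessel_summable B)
  ultimately show ?thesis
    unfolding s_def by (metis has_sum_infsum)
qed

lemma parseval:
  fixes B :: "'a::{real_inner,banach} set"
  assumes "orthonormal_basis B"
  shows "((\<lambda>e. (x \<bullet> e)\<^sup>2) has_sum (norm x)\<^sup>2) B"
  using has_sum_bounded_linear[OF bounded_linear_inner_right[of x] fourier_expansion[OF assms, of x]]
  by (simp add: power2_norm_eq_inner) (simp add: power2_eq_square)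

section \<open>Hilbert-Schmidt operators\<close>

definition hilbert_schmidt :: "('a::{real_inner,banach} \<Rightarrow>\<^sub>L 'a) \<Rightarrow> bool" where
  "hilbert_schmidt A \<longleftrightarrow> (\<lambda>e. (norm (blinfun_apply A e))\<^sup>2) summable_on onb"

lemma hilbert_schmidt_0: "hilbert_schmidt 0"
  by (simp add: hilbert_schmidt_def)

lemma hilbert_schmidt_scaleR: "hilbert_schmidt A \<Longrightarrow> hilbert_schmidt (r *\<^sub>R A)"
  unfolding hilbert_schmidt_def
  by (simp add: blinfun.scaleR_left power_mult_distrib summable_on_cmult_right)

lemma hilbert_schmidt_add:
  assumes "hilbert_schmidt A" "hilbert_schmidt B"
  shows "hilbert_schmidt (A + B)"
proof -
  have "(\<lambda>e. 2 * (norm (blinfun_apply A e))\<^sup>2 + 2 * (norm (blinfun_apply B e))\<^sup>2) summable_on onb"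
    using assms by (intro summable_on_add summable_on_cmult_right) (auto simp: hilbert_schmidt_def)
  then show ?thesis
    unfolding hilbert_schmidt_def
  proof (rule summable_on_comparison_test)
    fix e :: 'a
    have "(norm (blinfun_apply (A + B) e))\<^sup>2 \<le> (norm (blinfun_apply A e) + norm (blinfun_apply B e))\<^sup>2"
      by (simp add: blinfun.add_left norm_triangle_ineq power_mono)
    also have "\<dots> \<le> 2 * (norm (blinfun_apply A e))\<^sup>2 + 2 * (norm (blinfun_apply B e))\<^sup>2"
      using sum_squares_bound[of "norm (blinfun_apply A e)" "norm (blinfun_apply B e)"]
      by (simp add: power2_sum)
    finally show "(norm (blinfun_apply (A + B) e))\<^sup>2 \<le> 2 * (norm (blinfun_apply A e))\<^sup>2 + 2 * (norm (blinfun_apply B e))\<^sup>2" .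
  qed auto
qed

lemma hilbert_schmidt_uminus: "hilbert_schmidt A \<Longrightarrow> hilbert_schmidt (- A)"
  using hilbert_schmidt_scaleR[of A "-1"] by simp

lemma hilbert_schmidt_diff:
  "hilbert_schmidt A \<Longrightarrow> hilbert_schmidt B \<Longrightarrow> hilbert_schmidt (A - B)"
  using hilbert_schmidt_add[of A "- B"] hilbert_schmidt_uminus[of B] by simp

lemma hilbert_schmidt_inner_summable:
  assumes "hilbert_schmidt A" "hilbert_schmidt B"
  shows "(\<lambda>e. blinfun_apply A e \<bullet> blinfun_apply B e) summable_on onb"
proof -
  have "(\<lambda>e. (norm (blinfun_apply A e))\<^sup>2 + (norm (blinfun_apply B e))\<^sup>2) summable_on onb"
    using assms by (intro summable_on_add) (auto simp: hilbert_schmidt_def)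
  then have "(\<lambda>e. norm (blinfun_apply A e \<bullet> blinfun_apply B e)) summable_on onb"
  proof (rule summable_on_comparison_test)
    fix e :: 'a
    have "norm (blinfun_apply A e \<bullet> blinfun_apply B e) \<le> norm (blinfun_apply A e) * norm (blinfun_apply B e)"
      by (simp add: Cauchy_Schwarz_ineq2)
    also have "\<dots> \<le> (norm (blinfun_apply A e))\<^sup>2 + (norm (blinfun_apply B e))\<^sup>2"
      using sum_squares_bound[of "norm (blinfun_apply A e)" "norm (blinfun_apply B e)"]
        mult_nonneg_nonneg[OF norm_ge_zero[of "blinfun_apply A e"] norm_ge_zero[of "blinfun_apply B e"]]
      by linarith
    finally show "norm (blinfun_apply A e \<bullet> blinfun_apply B e)
        \<le> (norm (blinfun_apply A e))\<^sup>2 + (norm (blinfun_apply B e))\<^sup>2" .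
  qed auto
  then show ?thesis by (rule abs_summable_summable)
qed

lemma hilbert_schmidt_norm_bound:
  assumes "hilbert_schmidt A"
  shows "norm A \<le> sqrt (\<Sum>\<^sub>\<infinity>e\<in>onb. (norm (blinfun_apply A e))\<^sup>2)"
proof (rule norm_blinfun_bound)
  let ?S = "\<Sum>\<^sub>\<infinity>e\<in>onb. (norm (blinfun_apply A e))\<^sup>2"
  show "0 \<le> sqrt ?S" by (simp add: infsum_nonneg)
  fix x
  have "((\<lambda>e. (x \<bullet> e) *\<^sub>R blinfun_apply A e) has_sum blinfun_apply A x) onb"
    using has_sum_bounded_linear[OF blinfun.bounded_linear_right[of A] fourier_expansion[OF orthonormal_basis_onb, of x]]
    by (simp add: blinfun.scaleR_right)
  then have lim: "(sum (\<lambda>e. (x \<bullet> e) *\<^sub>R blinfun_apply A e) \<longlongrightarrow> blinfun_apply A x) (finite_subsets_at_top onb)"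
    by (simp add: has_sum_def)
  have bd: "norm (\<Sum>e\<in>F. (x \<bullet> e) *\<^sub>R blinfun_apply A e) \<le> sqrt ?S * norm x"
    if F: "finite F" "F \<subseteq> onb" for F
  proof -
    have "norm (\<Sum>e\<in>F. (x \<bullet> e) *\<^sub>R blinfun_apply A e) \<le> (\<Sum>e\<in>F. \<bar>x \<bullet> e\<bar> * \<bar>norm (blinfun_apply A e)\<bar>)"
      by (rule order.trans[OF norm_sum]) simp
    also have "\<dots> \<le> L2_set (\<lambda>e. x \<bullet> e) F * L2_set (\<lambda>e. norm (blinfun_apply A e)) F"
      by (rule L2_set_mult_ineq)
    also have "\<dots> \<le> norm x * sqrt ?S"
    proof (rule mult_mono)
      show "L2_set (\<lambda>e. x \<bullet> e) F \<le> norm x"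
        unfolding L2_set_def by (rule real_le_lsqrt) (use bessel_finite[OF orthonormal_onb F] in auto)
      show "L2_set (\<lambda>e. norm (blinfun_apply A e)) F \<le> sqrt ?S"
        unfolding L2_set_def using assms F
        by (intro real_sqrt_le_mono finite_sum_le_infsum) (auto simp: hilbert_schmidt_def)
    qed auto
    finally show ?thesis by (simp add: mult.commute)
  qed
  show "norm (blinfun_apply A x) \<le> sqrt ?S * norm x"
    by (rule tendsto_upperbound[OF tendsto_norm[OF lim]])
      (auto intro!: eventually_finite_subsets_at_top_weakI bd)
qed

typedef (overloaded) 'a hs_op = "{A :: 'a::{real_inner,banach} \<Rightarrow>\<^sub>L 'a. hilbert_schmidt A}"
  morphisms op_of_hs Abs_hs
  using hilbert_schmidt_0 by blast

setup_lifting type_definition_hs_op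

lemma hilbert_schmidt_op_of_hs [simp]: "hilbert_schmidt (op_of_hs A)"
  using op_of_hs[of A] by simp

text \<open>The sums are taken over the fixed basis \<^const>\<open>onb\<close>; by \<open>hilbert_schmidt_iff_basis\<close> and
  \<open>norm_hs_op_basis\<close> below, every orthonormal basis gives the same operators and the same norm.\<close>

instantiation hs_op :: ("{real_inner,banach}") real_inner
begin

lift_definition zero_hs_op :: "'a hs_op" is 0 by (rule hilbert_schmidt_0)
lift_definition plus_hs_op :: "'a hs_op \<Rightarrow> 'a hs_op \<Rightarrow> 'a hs_op" is "(+)" by (rule hilbert_schmidt_add)
lift_definition minus_hs_op :: "'a hs_op \<Rightarrow> 'a hs_op \<Rightarrow> 'a hs_op" is "(-)" by (rule hilbert_schmidt_diff)
lift_definition uminus_hs_op :: "'a hs_op \<Rightarrow> 'a hs_op" is uminus by (rule hilbert_schmidt_uminus)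
lift_definition scaleR_hs_op :: "real \<Rightarrow> 'a hs_op \<Rightarrow> 'a hs_op" is scaleR by (rule hilbert_schmidt_scaleR)

definition inner_hs_op :: "'a hs_op \<Rightarrow> 'a hs_op \<Rightarrow> real" where
  "A \<bullet> B = (\<Sum>\<^sub>\<infinity>e\<in>onb. blinfun_apply (op_of_hs A) e \<bullet> blinfun_apply (op_of_hs B) e)"

definition norm_hs_op :: "'a hs_op \<Rightarrow> real" where
  "norm (A :: 'a hs_op) = sqrt (A \<bullet> A)"

definition dist_hs_op :: "'a hs_op \<Rightarrow> 'a hs_op \<Rightarrow> real" where
  "dist A B = norm (A - B :: 'a hs_op)"

definition sgn_hs_op :: "'a hs_op \<Rightarrow> 'a hs_op" where
  "sgn A = inverse (norm A) *\<^sub>R (A :: 'a hs_op)"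

definition uniformity_hs_op :: "('a hs_op \<times> 'a hs_op) filter" where
  "uniformity_hs_op = (INF \<epsilon>\<in>{0<..}. principal {(x, y). dist x y < \<epsilon>})"

definition open_hs_op :: "'a hs_op set \<Rightarrow> bool" where
  "open_hs_op S = (\<forall>x\<in>S. \<forall>\<^sub>F (x', y) in uniformity. x' = x \<longrightarrow> y \<in> S)"

instance
proof
  fix A B C :: "'a hs_op" and r s :: real
  show "A + B + C = A + (B + C)" "A + B = B + A" "0 + A = A" "- A + A = 0" "A - B = A + - B"
    "r *\<^sub>R (A + B) = r *\<^sub>R A + r *\<^sub>R B" "(r + s) *\<^sub>R A = r *\<^sub>R A + s *\<^sub>R A"
    "r *\<^sub>R s *\<^sub>R A = (r * s) *\<^sub>R A" "1 *\<^sub>R A = A"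
    by (transfer, simp add: algebra_simps)+
  show "dist A B = norm (A - B)" by (rule dist_hs_op_def)
  show "sgn A = inverse (norm A) *\<^sub>R A" by (rule sgn_hs_op_def)
  show "(uniformity :: ('a hs_op \<times> 'a hs_op) filter) = (INF \<epsilon>\<in>{0<..}. principal {(x, y). dist x y < \<epsilon>})"
    by (rule uniformity_hs_op_def)
  show "open U = (\<forall>x\<in>U. \<forall>\<^sub>F (x', y) in uniformity. x' = x \<longrightarrow> y \<in> U)" for U :: "'a hs_op set"
    by (rule open_hs_op_def)
  show "A \<bullet> B = B \<bullet> A" by (simp add: inner_hs_op_def inner_commute)
  show "(A + B) \<bullet> C = A \<bullet> C + B \<bullet> C"
    by (simp add: inner_hs_op_def plus_hs_op.rep_eq blinfun.add_left inner_add_left infsum_add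
        hilbert_schmidt_inner_summable)
  show "(r *\<^sub>R A) \<bullet> B = r * (A \<bullet> B)"
    by (simp add: inner_hs_op_def scaleR_hs_op.rep_eq blinfun.scaleR_left infsum_cmult_right')
  show "0 \<le> A \<bullet> A" by (simp add: inner_hs_op_def infsum_nonneg)
  show "A \<bullet> A = 0 \<longleftrightarrow> A = 0"
  proof
    assume "A \<bullet> A = 0"
    then have "norm (op_of_hs A) \<le> 0"
      using hilbert_schmidt_norm_bound[of "op_of_hs A"]
      by (simp add: inner_hs_op_def power2_norm_eq_inner)
    then show "A = 0" by (transfer, simp)
  next
    assume "A = 0"
    then show "A \<bullet> A = 0" by (simp add: inner_hs_op_def zero_hs_op.rep_eq)
  qed
  show "norm A = sqrt (A \<bullet> A)" by (rule norm_hs_op_def)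
qed

end

lemma norm_hs_op_eq: "norm A = sqrt (\<Sum>\<^sub>\<infinity>e\<in>onb. (norm (blinfun_apply (op_of_hs A) e))\<^sup>2)"
  by (simp add: norm_hs_op_def inner_hs_op_def power2_norm_eq_inner)

lemma norm_op_of_hs_le: "norm (op_of_hs A) \<le> norm A"
  unfolding norm_hs_op_eq by (rule hilbert_schmidt_norm_bound) simp

instance hs_op :: ("{real_inner,banach}") banach
proof
  fix X :: "nat \<Rightarrow> 'a hs_op" assume X: "Cauchy X"
  have "Cauchy (\<lambda>n. op_of_hs (X n))"
    unfolding Cauchy_def
  proof safe
    fix \<epsilon> :: real assume "\<epsilon> > 0"
    then obtain K where K: "\<And>m n. m \<ge> K \<Longrightarrow> n \<ge> K \<Longrightarrow> dist (X m) (X n) < \<epsilon>"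
      using X unfolding Cauchy_def by blast
    have "dist (op_of_hs (X m)) (op_of_hs (X n)) \<le> dist (X m) (X n)" for m n
      using norm_op_of_hs_le[of "X m - X n"] by (simp add: dist_norm minus_hs_op.rep_eq)
    then show "\<exists>K. \<forall>m\<ge>K. \<forall>n\<ge>K. dist (op_of_hs (X m)) (op_of_hs (X n)) < \<epsilon>"
      using K by (meson le_less_trans)
  qed
  then obtain A where A: "(\<lambda>n. op_of_hs (X n)) \<longlonglongrightarrow> A"
    using Cauchy_convergent convergent_def by blast
  have tail: "\<exists>K. \<forall>m\<ge>K. \<forall>F. finite F \<and> F \<subseteq> onb \<longrightarrow>
      (\<Sum>e\<in>F. (norm (blinfun_apply (op_of_hs (X m) - A) e))\<^sup>2) \<le> \<epsilon>\<^sup>2" if "\<epsilon> > 0" for \<epsilon> :: real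
  proof -
    obtain K where K: "\<And>m n. m \<ge> K \<Longrightarrow> n \<ge> K \<Longrightarrow> dist (X m) (X n) < \<epsilon>"
      using X \<open>\<epsilon> > 0\<close> unfolding Cauchy_def by blast
    have "(\<Sum>e\<in>F. (norm (blinfun_apply (op_of_hs (X m) - A) e))\<^sup>2) \<le> \<epsilon>\<^sup>2"
      if m: "m \<ge> K" and F: "finite F" "F \<subseteq> onb" for m F
    proof (rule tendsto_upperbound)
      show "(\<lambda>n. \<Sum>e\<in>F. (norm (blinfun_apply (op_of_hs (X m) - op_of_hs (X n)) e))\<^sup>2)
          \<longlonglongrightarrow> (\<Sum>e\<in>F. (norm (blinfun_apply (op_of_hs (X m) - A) e))\<^sup>2)"
        by (intro tendsto_intros A)
      have "(\<Sum>e\<in>F. (norm (blinfun_apply (op_of_hs (X m) - op_of_hs (X n)) e))\<^sup>2) \<le> \<epsilon>\<^sup>2" if "n \<ge> K" for n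
      proof -
        have "(\<Sum>e\<in>F. (norm (blinfun_apply (op_of_hs (X m - X n)) e))\<^sup>2)
            \<le> (\<Sum>\<^sub>\<infinity>e\<in>onb. (norm (blinfun_apply (op_of_hs (X m - X n)) e))\<^sup>2)"
          by (rule finite_sum_le_infsum)
            (use F hilbert_schmidt_op_of_hs[of "X m - X n"] in \<open>auto simp: hilbert_schmidt_def\<close>)
        also have "\<dots> = (norm (X m - X n))\<^sup>2"
          by (simp add: norm_hs_op_eq infsum_nonneg)
        also have "\<dots> \<le> \<epsilon>\<^sup>2"
          using K[OF m that] by (intro power_mono) (auto simp: dist_norm)
        finally show ?thesis by (simp add: minus_hs_op.rep_eq)
      qed
      then show "\<forall>\<^sub>F n in sequentially.
          (\<Sum>e\<in>F. (norm (blinfun_apply (op_of_hs (X m) - op_of_hs (X n)) e))\<^sup>2) \<le> \<epsilon>\<^sup>2"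
        by (auto simp: eventually_sequentially)
    qed simp
    then show ?thesis by blast
  qed
  have hs: "hilbert_schmidt (op_of_hs (X m) - A)"
    if "\<And>F. finite F \<Longrightarrow> F \<subseteq> onb \<Longrightarrow>
      (\<Sum>e\<in>F. (norm (blinfun_apply (op_of_hs (X m) - A) e))\<^sup>2) \<le> \<epsilon>\<^sup>2" for m and \<epsilon> :: real
    unfolding hilbert_schmidt_def
    by (rule nonneg_bdd_above_summable_on) (auto intro!: bdd_aboveI[of _ "\<epsilon>\<^sup>2"] that)
  have "hilbert_schmidt A"
  proof -
    obtain m where "\<And>F. finite F \<Longrightarrow> F \<subseteq> onb \<Longrightarrow>
        (\<Sum>e\<in>F. (norm (blinfun_apply (op_of_hs (X m) - A) e))\<^sup>2) \<le> 1\<^sup>2"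
      using tail[OF zero_less_one] by blast
    then have "hilbert_schmidt (op_of_hs (X m) - A)" by (rule hs)
    from hilbert_schmidt_diff[OF hilbert_schmidt_op_of_hs[of "X m"] this] show ?thesis by simp
  qed
  then have opA: "op_of_hs (Abs_hs A) = A" by (simp add: Abs_hs_inverse)
  have "X \<longlonglongrightarrow> Abs_hs A"
    unfolding LIMSEQ_def
  proof safe
    fix \<epsilon> :: real assume "\<epsilon> > 0"
    then obtain K where K: "\<And>m F. m \<ge> K \<Longrightarrow> finite F \<Longrightarrow> F \<subseteq> onb \<Longrightarrow>
        (\<Sum>e\<in>F. (norm (blinfun_apply (op_of_hs (X m) - A) e))\<^sup>2) \<le> (\<epsilon> / 2)\<^sup>2"
      using tail[OF half_gt_zero[OF \<open>\<epsilon> > 0\<close>]] by blast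
    have "dist (X m) (Abs_hs A) < \<epsilon>" if "m \<ge> K" for m
    proof -
      have "(\<Sum>\<^sub>\<infinity>e\<in>onb. (norm (blinfun_apply (op_of_hs (X m) - A) e))\<^sup>2) \<le> (\<epsilon> / 2)\<^sup>2"
        using hs[OF K[OF that]] by (intro infsum_le_finite_sums K that) (auto simp: hilbert_schmidt_def)
      then have "norm (X m - Abs_hs A) \<le> \<epsilon> / 2"
        unfolding norm_hs_op_eq minus_hs_op.rep_eq opA
        using \<open>\<epsilon> > 0\<close> by (intro real_le_lsqrt) auto
      then show ?thesis using \<open>\<epsilon> > 0\<close> by (simp add: dist_norm)
    qed
    then show "\<exists>K. \<forall>m\<ge>K. dist (X m) (Abs_hs A) < \<epsilon>" by blast
  qed
  then show "convergent X" by (auto simp: convergent_def)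
qed

definition blinfun_adjoint :: "('a::{real_inner,banach} \<Rightarrow>\<^sub>L 'a) \<Rightarrow> 'a \<Rightarrow>\<^sub>L 'a" where
  "blinfun_adjoint A = Blinfun (adjoint (blinfun_apply A))"

lemma riesz_representation:
  fixes f :: "'a::{real_inner,banach} \<Rightarrow> real"
  assumes "bounded_linear f"
  obtains z where "\<And>x. f x = x \<bullet> z"
proof -
  interpret f: bounded_linear f by fact
  obtain K where K: "\<And>x. norm (f x) \<le> norm x * K" using f.bounded by blast
  have "(\<Sum>e\<in>F. (f e)\<^sup>2) \<le> K\<^sup>2" if F: "finite F" "F \<subseteq> onb" for F
  proof -
    let ?S = "\<Sum>e\<in>F. (f e)\<^sup>2" and ?v = "\<Sum>e\<in>F. f e *\<^sub>R e"
    have "?S = f ?v" by (simp add: f.sum f.scaleR power2_eq_square)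
    then have "?S\<^sup>2 \<le> (norm ?v * K)\<^sup>2"
      using power_mono[OF K[of ?v], of 2] by simp
    also have "\<dots> = ?S * K\<^sup>2"
      by (simp add: power_mult_distrib orthonormal_norm_sum[OF orthonormal_onb F])
    finally have "?S * ?S \<le> ?S * K\<^sup>2" by (simp add: power2_eq_square)
    then show ?thesis
      by (cases "?S = 0") (auto simp: sum_nonneg less_le intro: mult_left_le_imp_le)
  qed
  then have "(\<lambda>e. (f e)\<^sup>2) summable_on onb"
    by (intro nonneg_bdd_above_summable_on bdd_aboveI[of _ "K\<^sup>2"]) auto
  then have "(\<lambda>e. f e *\<^sub>R e) summable_on onb"
    by (rule orthonormal_summable[OF orthonormal_onb])
  then have z: "((\<lambda>e. f e *\<^sub>R e) has_sum (\<Sum>\<^sub>\<infinity>e\<in>onb. f e *\<^sub>R e)) onb"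
    by (rule has_sum_infsum)
  have "f x = x \<bullet> (\<Sum>\<^sub>\<infinity>e\<in>onb. f e *\<^sub>R e)" for x
  proof (rule has_sum_unique)
    show "((\<lambda>e. (x \<bullet> e) * f e) has_sum f x) onb"
      using has_sum_bounded_linear[OF assms fourier_expansion[OF orthonormal_basis_onb, of x]]
      by (simp add: f.scaleR)
    show "((\<lambda>e. (x \<bullet> e) * f e) has_sum (x \<bullet> (\<Sum>\<^sub>\<infinity>e\<in>onb. f e *\<^sub>R e))) onb"
      using has_sum_bounded_linear[OF bounded_linear_inner_right[of x] z] by (simp add: mult.commute)
  qed
  then show ?thesis by (rule that)
qed

lemma blinfun_adjoint_works: "blinfun_apply A x \<bullet> y = x \<bullet> blinfun_apply (blinfun_adjoint A) y"
proof -
  have "\<exists>z. \<forall>x. blinfun_apply A x \<bullet> y = x \<bullet> z" for y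
  proof -
    have "bounded_linear (\<lambda>x. blinfun_apply A x \<bullet> y)"
      by (intro bounded_linear_inner_left_comp blinfun.bounded_linear_right)
    then show ?thesis by (rule riesz_representation) blast
  qed
  then obtain g where g: "\<And>x y. blinfun_apply A x \<bullet> y = x \<bullet> g y" by metis
  have "adjoint (blinfun_apply A) = g"
    by (rule adjoint_unique) (use g in auto)
  moreover have "bounded_linear g"
  proof (rule bounded_linear_intro)
    show "g (x + y) = g x + g y" for x y
      by (rule vector_eq_ldot[THEN iffD1]) (simp add: g[symmetric] inner_add_right)
    show "g (r *\<^sub>R x) = r *\<^sub>R g x" for r x
      by (rule vector_eq_ldot[THEN iffD1]) (simp add: g[symmetric])
    show "norm (g y) \<le> norm y * norm A" for y
    proof (cases "g y = 0")
      case False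
      have "norm (g y) * norm (g y) = blinfun_apply A (g y) \<bullet> y"
        by (simp add: g power2_norm_eq_inner[symmetric] power2_eq_square[symmetric])
      also have "\<dots> \<le> norm (blinfun_apply A (g y)) * norm y"
        by (rule norm_cauchy_schwarz)
      also have "\<dots> \<le> (norm A * norm (g y)) * norm y"
        by (intro mult_right_mono norm_blinfun) auto
      finally have "norm (g y) * norm (g y) \<le> norm (g y) * (norm y * norm A)"
        by (simp add: mult_ac)
      then show ?thesis using False by (simp add: mult_left_le_imp_le)
    qed simp
  qed
  ultimately show ?thesis
    by (simp add: blinfun_adjoint_def bounded_linear_Blinfun_apply g)
qed

lemma hilbert_schmidt_adjoint_basis:
  assumes B: "orthonormal_basis B" and B': "orthonormal_basis B'"
    and A: "((\<lambda>e. (norm (blinfun_apply A e))\<^sup>2) has_sum S) B"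
  shows "((\<lambda>f. (norm (blinfun_apply (blinfun_adjoint A) f))\<^sup>2) has_sum S) B'"
proof -
  have 1: "((\<lambda>f. (blinfun_apply A e \<bullet> f)\<^sup>2) has_sum (norm (blinfun_apply A e))\<^sup>2) B'" for e
    by (rule parseval[OF B'])
  have 2: "((\<lambda>e. (blinfun_apply A e \<bullet> f)\<^sup>2) has_sum (norm (blinfun_apply (blinfun_adjoint A) f))\<^sup>2) B" for f
    using parseval[OF B, of "blinfun_apply (blinfun_adjoint A) f"]
    by (simp add: blinfun_adjoint_works inner_commute[of _ "blinfun_apply (blinfun_adjoint A) f"])
  have "(\<lambda>(e, f). (blinfun_apply A e \<bullet> f)\<^sup>2) summable_on (B \<times> B')"
    by (rule summable_on_SigmaI[where g = "\<lambda>e. (norm (blinfun_apply A e))\<^sup>2"])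
      (use 1 A in \<open>auto intro: has_sum_imp_summable\<close>)
  then have "((\<lambda>(e, f). (blinfun_apply A e \<bullet> f)\<^sup>2) has_sum S) (B \<times> B')"
    using has_sum_SigmaI[OF _ A, of "\<lambda>(e, f). (blinfun_apply A e \<bullet> f)\<^sup>2" "\<lambda>_. B'"] 1 by simp
  then have "((\<lambda>(f, e). (blinfun_apply A e \<bullet> f)\<^sup>2) has_sum S) (B' \<times> B)"
    by (subst (asm) has_sum_swap) simp
  from has_sum_SigmaD[OF this] 2 show ?thesis by simp
qed

lemma blinfun_adjoint_adjoint: "blinfun_adjoint (blinfun_adjoint A) = A"
proof (rule blinfun_eqI)
  fix x
  have "y \<bullet> blinfun_apply (blinfun_adjoint (blinfun_adjoint A)) x = y \<bullet> blinfun_apply A x" for y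
    using blinfun_adjoint_works[of "blinfun_adjoint A" y x] blinfun_adjoint_works[of A x y]
    by (simp only: inner_commute[of x] inner_commute[of "blinfun_apply A x"])
  then show "blinfun_apply (blinfun_adjoint (blinfun_adjoint A)) x = blinfun_apply A x"
    using vector_eq_ldot by blast
qed

lemma has_sum_norm_basis_iff:
  fixes A :: "'a::{real_inner,banach} \<Rightarrow>\<^sub>L 'a"
  assumes "orthonormal_basis B" "orthonormal_basis B'"
  shows "((\<lambda>e. (norm (blinfun_apply A e))\<^sup>2) has_sum S) B \<longleftrightarrow>
    ((\<lambda>e. (norm (blinfun_apply A e))\<^sup>2) has_sum S) B'"
  using hilbert_schmidt_adjoint_basis[OF assms(1) assms(1), of A S]
    hilbert_schmidt_adjoint_basis[OF assms(2) assms(2), of A S]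
    hilbert_schmidt_adjoint_basis[OF assms(1) assms(2), of "blinfun_adjoint A" S]
    hilbert_schmidt_adjoint_basis[OF assms(2) assms(1), of "blinfun_adjoint A" S]
  by (auto simp: blinfun_adjoint_adjoint)

lemma hilbert_schmidt_iff_basis:
  assumes "orthonormal_basis B"
  shows "hilbert_schmidt A \<longleftrightarrow> (\<lambda>e. (norm (blinfun_apply A e))\<^sup>2) summable_on B"
  unfolding hilbert_schmidt_def summable_on_def
  using has_sum_norm_basis_iff[OF assms orthonormal_basis_onb] by blast

lemma norm_hs_op_basis:
  assumes "orthonormal_basis B"
  shows "norm A = sqrt (\<Sum>\<^sub>\<infinity>e\<in>B. (norm (blinfun_apply (op_of_hs A) e))\<^sup>2)"
proof -
  have "((\<lambda>e. (norm (blinfun_apply (op_of_hs A) e))\<^sup>2)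
      has_sum (\<Sum>\<^sub>\<infinity>e\<in>onb. (norm (blinfun_apply (op_of_hs A) e))\<^sup>2)) onb"
    using hilbert_schmidt_op_of_hs[of A] unfolding hilbert_schmidt_def by (rule has_sum_infsum)
  then show ?thesis
    using has_sum_norm_basis_iff[OF assms orthonormal_basis_onb] by (metis infsumI norm_hs_op_eq)
qed

section \<open>Non-negative definite and trace class operators\<close>

definition nonneg_definite :: "('a::{real_inner,banach} \<Rightarrow>\<^sub>L 'a) \<Rightarrow> bool" where
  "nonneg_definite A \<longleftrightarrow> blinfun_adjoint A = A \<and> (\<forall>x. 0 \<le> blinfun_apply A x \<bullet> x)"

definition op_sqrt :: "('a::{real_inner,banach} \<Rightarrow>\<^sub>L 'a) \<Rightarrow> 'a \<Rightarrow>\<^sub>L 'a" where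
  "op_sqrt A = (THE R. nonneg_definite R \<and> R o\<^sub>L R = A)"

definition compact_op :: "('a::{real_inner,banach} \<Rightarrow>\<^sub>L 'a) \<Rightarrow> bool" where
  "compact_op A \<longleftrightarrow> compact (closure (blinfun_apply A ` cball 0 1))"

text \<open>The Hilbert-Schmidt norm of an arbitrary bounded operator, infinite off \<^typ>\<open>'a hs_op\<close>.\<close>

definition hs_enorm :: "('a::{real_inner,banach} \<Rightarrow>\<^sub>L 'a) \<Rightarrow> ennreal" where
  "hs_enorm A = (if hilbert_schmidt A then ennreal (norm (Abs_hs A)) else \<infinity>)"

definition trace_norm :: "('a::{real_inner,banach} \<Rightarrow>\<^sub>L 'a) \<Rightarrow> ennreal" where
  "trace_norm A = (hs_enorm (op_sqrt (op_sqrt (blinfun_adjoint A o\<^sub>L A))))\<^sup>2"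

definition trace_class :: "('a::{real_inner,banach} \<Rightarrow>\<^sub>L 'a) \<Rightarrow> bool" where
  "trace_class A \<longleftrightarrow> compact_op A \<and> trace_norm A < \<infinity>"

section \<open>Compound Poisson processes\<close>

locale poisson_process = prob_space M for M :: "'w measure" +
  fixes rate :: real and N :: "real \<Rightarrow> 'w \<Rightarrow> nat"
  assumes rate_pos: "rate > 0"
    and N_measurable: "\<And>t. 0 \<le> t \<Longrightarrow> random_variable (count_space UNIV) (N t)"
    and indep_increments: "\<And>(t :: nat \<Rightarrow> real) n. 0 \<le> t 0 \<Longrightarrow> strict_mono t \<Longrightarrow>
      indep_vars (\<lambda>_. count_space UNIV) (\<lambda>i \<omega>. N (t (Suc i)) \<omega> - N (t i) \<omega>) {..<n}"
    and poisson_increments: "\<And>s t. 0 \<le> s \<Longrightarrow> s < t \<Longrightarrow>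
      distr M (count_space UNIV) (\<lambda>\<omega>. N t \<omega> - N s \<omega>) = measure_pmf (poisson_pmf (rate * (t - s)))"
    and paths: "AE \<omega> in M. N 0 \<omega> = 0 \<and> mono_on {0..} (\<lambda>t. N t \<omega>)
      \<and> (\<forall>t\<ge>0. continuous (at_right t) (\<lambda>s. N s \<omega>))"

locale compound_poisson_process = poisson_process M rate N
  for M :: "'w measure" and rate :: real and N :: "real \<Rightarrow> 'w \<Rightarrow> nat" +
  fixes X :: "nat \<Rightarrow> 'w \<Rightarrow> 'v::real_normed_vector"
  assumes jumps_indep: "indep_vars (\<lambda>_. borel) X {1..}"
    and jumps_identically_distributed: "\<And>i. 1 \<le> i \<Longrightarrow> distr M borel (X i) = distr M borel (X 1)"
    and jumps_indep_N: "indep_set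
      (sets (vimage_algebra (space M) (\<lambda>\<omega>. \<lambda>i\<in>{1..}. X i \<omega>) (\<Pi>\<^sub>M i\<in>{1..}. borel)))
      (sets (vimage_algebra (space M) (\<lambda>\<omega>. \<lambda>t\<in>{0..}. N t \<omega>) (\<Pi>\<^sub>M t\<in>{0..}. count_space UNIV)))"

definition compound_process ::
    "(real \<Rightarrow> 'w \<Rightarrow> nat) \<Rightarrow> (nat \<Rightarrow> 'w \<Rightarrow> 'v::real_normed_vector) \<Rightarrow> real \<Rightarrow> 'w \<Rightarrow> 'v" where
  "compound_process N X t \<omega> = (\<Sum>i=1..N t \<omega>. X i \<omega>)"

section \<open>Ornstein-Uhlenbeck equations driven by step paths\<close>

definition blinfun_exp :: "('v::banach \<Rightarrow>\<^sub>L 'v) \<Rightarrow> 'v \<Rightarrow>\<^sub>L 'v" where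
  "blinfun_exp C = (\<Sum>n. (((o\<^sub>L) C) ^^ n) id_blinfun /\<^sub>R fact n)"

text \<open>For a right-continuous step path \<open>L\<close> with finitely many jumps in \<open>(0, t]\<close>, the integral of
  an operator-valued \<open>F\<close> with respect to \<open>L\<close> over \<open>(0, t]\<close> is the sum of the values of \<open>F\<close> at the
  jump times, applied to the jumps.\<close>

definition jump :: "(real \<Rightarrow> 'v::real_normed_vector) \<Rightarrow> real \<Rightarrow> 'v" where
  "jump L s = L s - Lim (at_left s) L"

definition step_integral ::
    "(real \<Rightarrow> 'v::real_normed_vector \<Rightarrow>\<^sub>L 'v) \<Rightarrow> (real \<Rightarrow> 'v) \<Rightarrow> real \<Rightarrow> 'v" where
  "step_integral F L t = (\<Sum>s | s \<in> {0<..t} \<and> jump L s \<noteq> 0. blinfun_apply (F s) (jump L s))"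

text \<open>The variation-of-constants solution of \<open>dV(t) = C V(t) dt + dL(t)\<close>, \<open>V(0) = v0\<close>.\<close>

definition ou_solution :: "('v::banach \<Rightarrow>\<^sub>L 'v) \<Rightarrow> 'v \<Rightarrow> (real \<Rightarrow> 'v) \<Rightarrow> real \<Rightarrow> 'v" where
  "ou_solution C v0 L t =
    blinfun_apply (blinfun_exp (t *\<^sub>R C)) v0
    + step_integral (\<lambda>s. blinfun_exp ((t - s) *\<^sub>R C)) L t"

end

theory Submission
  imports Defs
begin

text \<open>For almost every \<open>\<omega>\<close> and every \<open>t\<close> the estimate holds for the two operators \<open>A = V t \<omega>\<close> and
  \<open>B = V' n t \<omega>\<close> themselves; suprema and expectations only preserve it. It is the inequality
  of Powers and Stormer, \<open>\<parallel>\<surd>A - \<surd>B\<parallel>\<^sup>2 \<le> \<parallel>A - B\<parallel>\<^sub>1\<close> with the Hilbert-Schmidt norm on the left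
  (\<open>powers_stormer\<close>), for compact non-negative definite \<open>A\<close> and \<open>B\<close>.

  The reason for it is that \<open>T = \<surd>A - \<surd>B\<close> is again compact and self-adjoint, so that there is an
  orthonormal basis of eigenvectors, \<open>T e = \<mu> e\<close>. From
  \<open>A - B = (T (\<surd>A + \<surd>B) + (\<surd>A + \<surd>B) T) / 2\<close> one gets
  \<open>\<langle>(A - B) e, e\<rangle> = \<mu> \<langle>(\<surd>A + \<surd>B) e, e\<rangle>\<close>, and \<open>\<bar>\<mu>\<bar> \<le> \<langle>(\<surd>A + \<surd>B) e, e\<rangle>\<close> by positivity, hence
  \<open>\<parallel>T e\<parallel>\<^sup>2 = \<mu>\<^sup>2 \<le> \<bar>\<langle>(A - B) e, e\<rangle>\<bar>\<close> (\<open>diff_eigenbasis_square_bound\<close>). The right-hand side is at most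
  \<open>\<langle>\<bar>A - B\<bar> e, e\<rangle>\<close> (\<open>op_abs_self_adjoint\<close>), and these numbers sum to the trace norm.

  The spectral theorem for compact self-adjoint operators
  (\<open>compact_self_adjoint_eigenbasis\<close>) also supplies the square roots: existence by taking roots of
  the eigenvalues, and uniqueness as the case \<open>A = B\<close> of the bound above, applied to two arbitrary
  roots. The roots are compact because compactness of \<open>S\<^sup>2\<close> passes to \<open>S\<close>
  (\<open>compact_op_if_square_compact\<close>).\<close>

section \<open>Compact operators and subsequences\<close>

lemma compact_op_iff_convergent_subseq:
  "compact_op A \<longleftrightarrow>
    (\<forall>x. (\<forall>n. norm (x n) \<le> 1) \<longrightarrow>
      (\<exists>r. strict_mono (r :: nat \<Rightarrow> nat) \<and> convergent (\<lambda>n. blinfun_apply A (x (r n)))))"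
  (is "_ \<longleftrightarrow> ?seq")
proof
  assume A: "compact_op A"
  show ?seq
  proof (intro allI impI)
    fix x :: "nat \<Rightarrow> 'a" assume x: "\<forall>n. norm (x n) \<le> 1"
    have "seq_compact (closure (blinfun_apply A ` cball 0 1))"
      using A by (simp add: compact_op_def compact_eq_seq_compact_metric)
    moreover have "blinfun_apply A (x n) \<in> closure (blinfun_apply A ` cball 0 1)" for n
      using x by (intro closure_subset[THEN subsetD] imageI) auto
    ultimately obtain l r where "strict_mono (r :: nat \<Rightarrow> nat)"
        "((\<lambda>n. blinfun_apply A (x n)) \<circ> r) \<longlonglongrightarrow> l"
      using seq_compactE[of _ "\<lambda>n. blinfun_apply A (x n)"] by metis
    then show "\<exists>r. strict_mono (r :: nat \<Rightarrow> nat) \<and> convergent (\<lambda>n. blinfun_apply A (x (r n)))"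
      by (auto simp: o_def convergent_def)
  qed
next
  assume seq: ?seq
  have "seq_compact (closure (blinfun_apply A ` cball 0 1))"
  proof (rule seq_compactI)
    fix y :: "nat \<Rightarrow> 'a" assume y: "\<forall>n. y n \<in> closure (blinfun_apply A ` cball 0 1)"
    have "\<exists>x. norm x \<le> 1 \<and> dist (blinfun_apply A x) (y n) < inverse (real (Suc n))" for n
    proof -
      have "\<exists>z\<in>blinfun_apply A ` cball 0 1. dist z (y n) < inverse (real (Suc n))"
        by (rule closure_approachable[THEN iffD1, rule_format]) (use y in simp_all)
      then show ?thesis by auto
    qed
    then obtain x where x: "\<And>n. norm (x n) \<le> 1"
        and near: "\<And>n. dist (blinfun_apply A (x n)) (y n) < inverse (real (Suc n))"
      by metis
    obtain r l where r: "strict_mono (r :: nat \<Rightarrow> nat)"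
        and l: "(\<lambda>n. blinfun_apply A (x (r n))) \<longlonglongrightarrow> l"
      using seq x unfolding convergent_def by blast
    have "(\<lambda>n. dist (blinfun_apply A (x n)) (y n)) \<longlonglongrightarrow> 0"
      using near by (intro tendsto_sandwich[OF _ _ tendsto_const LIMSEQ_inverse_real_of_nat])
        (auto intro!: always_eventually less_imp_le)
    from LIMSEQ_subseq_LIMSEQ[OF this r]
    have yl: "(\<lambda>n. y (r n)) \<longlonglongrightarrow> l"
      using Lim_transform[OF l, of "\<lambda>n. y (r n)"]
      by (simp add: o_def dist_norm norm_minus_commute tendsto_norm_zero_iff)
    have "l \<in> closure (blinfun_apply A ` cball 0 1)"
      by (rule closed_sequentially[OF closed_closure _ yl]) (simp only: y)
    with yl show "\<exists>l\<in>closure (blinfun_apply A ` cball 0 1). \<exists>r. strict_mono r \<and> (y \<circ> r) \<longlonglongrightarrow> l"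
      using r by (auto simp: o_def)
  qed
  then show "compact_op A"
    by (simp add: compact_op_def compact_eq_seq_compact_metric)
qed

lemma compact_op_diff:
  assumes "compact_op A" "compact_op B"
  shows "compact_op (A - B)"
  unfolding compact_op_iff_convergent_subseq
proof (intro allI impI)
  fix x :: "nat \<Rightarrow> 'a" assume x: "\<forall>n. norm (x n) \<le> 1"
  obtain r where r: "strict_mono (r :: nat \<Rightarrow> nat)" "convergent (\<lambda>n. blinfun_apply A (x (r n)))"
    using assms(1) x unfolding compact_op_iff_convergent_subseq by blast
  obtain s where s: "strict_mono (s :: nat \<Rightarrow> nat)" "convergent (\<lambda>n. blinfun_apply B (x (r (s n))))"
    using assms(2)[unfolded compact_op_iff_convergent_subseq, rule_format, of "\<lambda>n. x (r n)"] x by blast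
  have "convergent (\<lambda>n. blinfun_apply A (x (r (s n))))"
    using convergent_subseq_convergent[OF r(2) s(1)] by (simp add: o_def)
  from convergent_diff[OF this s(2)]
  show "\<exists>r. strict_mono (r :: nat \<Rightarrow> nat) \<and> convergent (\<lambda>n. blinfun_apply (A - B) (x (r n)))"
    using strict_mono_o[OF r(1) s(1)]
    by (intro exI[of _ "r \<circ> s"]) (simp add: blinfun.diff_left)
qed

lemma compact_op_compose:
  assumes "compact_op A"
  shows "compact_op (B o\<^sub>L A)"
  unfolding compact_op_iff_convergent_subseq
proof (intro allI impI)
  fix x :: "nat \<Rightarrow> 'a" assume x: "\<forall>n. norm (x n) \<le> 1"
  obtain r where r: "strict_mono (r :: nat \<Rightarrow> nat)" "convergent (\<lambda>n. blinfun_apply A (x (r n)))"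
    using assms x unfolding compact_op_iff_convergent_subseq by blast
  then obtain l where l: "(\<lambda>n. blinfun_apply A (x (r n))) \<longlonglongrightarrow> l"
    by (auto simp: convergent_def)
  have "(\<lambda>n. blinfun_apply B (blinfun_apply A (x (r n)))) \<longlonglongrightarrow> blinfun_apply B l"
    by (intro blinfun.tendsto[OF tendsto_const] l)
  then show "\<exists>r. strict_mono (r :: nat \<Rightarrow> nat) \<and> convergent (\<lambda>n. blinfun_apply (B o\<^sub>L A) (x (r n)))"
    using r(1) by (auto simp: convergent_def)
qed

lemma self_adjoint_inner:
  "blinfun_adjoint A = A \<Longrightarrow> blinfun_apply A x \<bullet> y = x \<bullet> blinfun_apply A y"
  using blinfun_adjoint_works[of A x y] by simp

lemma self_adjointI:
  assumes "\<And>x y. blinfun_apply A x \<bullet> y = x \<bullet> blinfun_apply A y"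
  shows "blinfun_adjoint A = A"
proof (rule blinfun_eqI)
  fix y
  have "x \<bullet> blinfun_apply (blinfun_adjoint A) y = x \<bullet> blinfun_apply A y" for x
    using assms[of x y] by (simp add: blinfun_adjoint_works)
  then show "blinfun_apply (blinfun_adjoint A) y = blinfun_apply A y"
    using vector_eq_ldot by blast
qed

lemma self_adjoint_diff:
  "blinfun_adjoint A = A \<Longrightarrow> blinfun_adjoint B = B \<Longrightarrow> blinfun_adjoint (A - B) = A - B"
  by (rule self_adjointI) (simp add: blinfun.diff_left inner_diff self_adjoint_inner)

text \<open>Since \<open>\<parallel>S z\<parallel>\<^sup>2 = \<langle>S (S z), z\<rangle> \<le> \<parallel>S (S z)\<parallel> \<parallel>z\<parallel>\<close>, a bounded sequence whose images
  under \<open>S\<^sup>2\<close> are Cauchy has images under \<open>S\<close> that are Cauchy. This passes compactness from an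
  operator to any of its square roots.\<close>

lemma compact_op_if_square_compact:
  assumes sa: "blinfun_adjoint S = S" and sq: "compact_op (S o\<^sub>L S)"
  shows "compact_op S"
  unfolding compact_op_iff_convergent_subseq
proof (intro allI impI)
  fix x :: "nat \<Rightarrow> 'a" assume x: "\<forall>n. norm (x n) \<le> 1"
  obtain r where r: "strict_mono (r :: nat \<Rightarrow> nat)"
      and conv: "convergent (\<lambda>n. blinfun_apply (S o\<^sub>L S) (x (r n)))"
    using sq x unfolding compact_op_iff_convergent_subseq by blast
  have bound: "(norm (blinfun_apply S (x i) - blinfun_apply S (x j)))\<^sup>2
      \<le> 2 * norm (blinfun_apply (S o\<^sub>L S) (x i) - blinfun_apply (S o\<^sub>L S) (x j))" for i j
  proof -
    let ?z = "x i - x j"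
    have "(norm (blinfun_apply S ?z))\<^sup>2 = blinfun_apply (S o\<^sub>L S) ?z \<bullet> ?z"
      by (simp add: power2_norm_eq_inner self_adjoint_inner[OF sa])
    also have "\<dots> \<le> norm (blinfun_apply (S o\<^sub>L S) ?z) * norm ?z"
      by (rule norm_cauchy_schwarz)
    also have "\<dots> \<le> norm (blinfun_apply (S o\<^sub>L S) ?z) * 2"
      using norm_triangle_ineq4[of "x i" "x j"] x[rule_format, of i] x[rule_format, of j]
      by (intro mult_left_mono) auto
    finally show ?thesis by (simp add: blinfun.diff_right)
  qed
  have "Cauchy (\<lambda>n. blinfun_apply S (x (r n)))"
    unfolding Cauchy_def
  proof safe
    fix \<epsilon> :: real assume "\<epsilon> > 0"
    then have "\<epsilon>\<^sup>2 / 2 > 0" by simp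
    then obtain K where K: "\<And>i j. i \<ge> K \<Longrightarrow> j \<ge> K \<Longrightarrow>
        dist (blinfun_apply (S o\<^sub>L S) (x (r i))) (blinfun_apply (S o\<^sub>L S) (x (r j))) < \<epsilon>\<^sup>2 / 2"
      using convergent_Cauchy[OF conv] unfolding Cauchy_def by blast
    have "dist (blinfun_apply S (x (r i))) (blinfun_apply S (x (r j))) < \<epsilon>"
      if "i \<ge> K" "j \<ge> K" for i j
    proof (rule power_less_imp_less_base)
      show "(dist (blinfun_apply S (x (r i))) (blinfun_apply S (x (r j))))\<^sup>2 < \<epsilon>\<^sup>2"
        using K[OF that] bound[of "r i" "r j"] by (simp add: dist_norm)
    qed (use \<open>\<epsilon> > 0\<close> in simp)
    then show "\<exists>K. \<forall>i\<ge>K. \<forall>j\<ge>K. dist (blinfun_apply S (x (r i))) (blinfun_apply S (x (r j))) < \<epsilon>"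
      by blast
  qed
  then show "\<exists>r. strict_mono (r :: nat \<Rightarrow> nat) \<and> convergent (\<lambda>n. blinfun_apply S (x (r n)))"
    using r Cauchy_convergent by blast
qed

section \<open>The spectral theorem for compact self-adjoint operators\<close>

text \<open>Let \<open>m\<close> be the norm of \<open>T\<close> on \<open>W\<close>. A sequence in the unit ball of \<open>W\<close> on which
  \<open>\<parallel>T x\<parallel>\<close> tends to \<open>m\<close> is asymptotically an eigenvector of \<open>T\<^sup>2\<close> for \<open>m\<^sup>2\<close>, and
  compactness turns it into an actual one \<open>y\<close>. As \<open>T\<^sup>2 - m\<^sup>2 = (T - m) (T + m)\<close>, either \<open>T y + m y\<close> is
  an eigenvector of \<open>T\<close> for \<open>m\<close>, or it vanishes and \<open>y\<close> is one for \<open>- m\<close>.\<close>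

lemma compact_self_adjoint_eigenvector:
  fixes T :: "'a::{real_inner,banach} \<Rightarrow>\<^sub>L 'a"
  assumes sa: "blinfun_adjoint T = T" and cpt: "compact_op T"
    and W: "subspace W" "closed W" "W \<noteq> {0}" and inv: "\<And>x. x \<in> W \<Longrightarrow> blinfun_apply T x \<in> W"
  shows "\<exists>v \<mu>. v \<in> W \<and> v \<noteq> 0 \<and> blinfun_apply T v = \<mu> *\<^sub>R v"
proof (cases "\<forall>x\<in>W. blinfun_apply T x = 0")
  case True
  obtain v where "v \<in> W" "v \<noteq> 0"
    using W subspace_0[OF W(1)] by blast
  then show ?thesis using True by (intro exI[of _ v] exI[of _ 0]) auto
next
  case False
  then obtain w where w: "w \<in> W" "blinfun_apply T w \<noteq> 0" by blast
  define K where "K = {norm (blinfun_apply T x) |x. x \<in> W \<and> norm x \<le> 1}"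
  define m where "m = Sup K"
  have bdd: "bdd_above K"
  proof (rule bdd_aboveI)
    fix k assume "k \<in> K"
    then obtain x where x: "k = norm (blinfun_apply T x)" "norm x \<le> 1" by (auto simp: K_def)
    then show "k \<le> norm T"
      using norm_blinfun[of T x] mult_left_le[OF x(2), of "norm T"] by simp
  qed
  have "0 \<in> K"
    using subspace_0[OF W(1)] by (auto simp: K_def intro!: exI[of _ 0])
  have bound: "norm (blinfun_apply T x) \<le> m * norm x" if "x \<in> W" for x
  proof (cases "x = 0")
    case False
    have "norm (blinfun_apply T (x /\<^sub>R norm x)) \<in> K"
      unfolding K_def using that False subspace_scale[OF W(1)] by (auto intro!: exI[of _ "x /\<^sub>R norm x"])
    from cSup_upper[OF this bdd] show ?thesis
      using False by (simp add: m_def blinfun.scaleR_right field_simps)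
  qed simp
  have "m > 0"
  proof -
    have "0 < norm (blinfun_apply T w)" using w by simp
    also have "\<dots> \<le> m * norm w" by (rule bound[OF w(1)])
    finally show ?thesis by (simp add: zero_less_mult_iff not_less)
  qed
  have "\<exists>x. x \<in> W \<and> norm x \<le> 1 \<and> m - inverse (real (Suc n)) < norm (blinfun_apply T x)" for n
  proof -
    have "m - inverse (real (Suc n)) < Sup K" by (simp add: m_def)
    then show ?thesis
      using less_cSupE[of "m - inverse (real (Suc n))" K] \<open>0 \<in> K\<close> by (force simp: K_def)
  qed
  then obtain x where xW: "\<And>n. x n \<in> W" and x1: "\<And>n. norm (x n) \<le> 1"
      and xm: "\<And>n. m - inverse (real (Suc n)) < norm (blinfun_apply T (x n))"
    by metis
  have upper: "norm (blinfun_apply T (x n)) \<le> m" for n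
    unfolding m_def by (rule cSup_upper[OF _ bdd]) (use xW x1 in \<open>auto simp: K_def\<close>)
  have lim: "(\<lambda>n. norm (blinfun_apply T (x n))) \<longlonglongrightarrow> m"
  proof (rule tendsto_sandwich[OF _ _ _ tendsto_const])
    show "(\<lambda>n. m - inverse (real (Suc n))) \<longlonglongrightarrow> m"
      using tendsto_diff[OF tendsto_const[of m] LIMSEQ_inverse_real_of_nat] by simp
  qed (use xm upper in \<open>auto intro!: always_eventually less_imp_le\<close>)
  let ?d = "\<lambda>n. blinfun_apply T (blinfun_apply T (x n)) - m\<^sup>2 *\<^sub>R x n"
  have d_le: "(norm (?d n))\<^sup>2 \<le> m\<^sup>2 * (m\<^sup>2 - (norm (blinfun_apply T (x n)))\<^sup>2)" for n
  proof -
    let ?t = "blinfun_apply T (x n)"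
    have tx: "blinfun_apply T ?t \<bullet> x n = ?t \<bullet> ?t"
      by (simp add: self_adjoint_inner[OF sa])
    have "(norm (?d n))\<^sup>2 = (norm (blinfun_apply T ?t))\<^sup>2 - 2 * m\<^sup>2 * (norm ?t)\<^sup>2 + m^4 * (norm (x n))\<^sup>2"
      unfolding power2_norm_eq_inner inner_diff_left inner_diff_right
        inner_scaleR_left inner_scaleR_right inner_commute[of "x n" "blinfun_apply T ?t"] tx
      by (simp add: algebra_simps power4_eq_xxxx power2_eq_square)
    also have "(norm (blinfun_apply T ?t))\<^sup>2 \<le> m\<^sup>2 * (norm ?t)\<^sup>2"
      using power_mono[OF bound[OF inv[OF xW]], of n 2] by (simp add: power_mult_distrib)
    also have "m^4 * (norm (x n))\<^sup>2 \<le> m^4 * 1"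
      using x1 by (intro mult_left_mono power_le_one) auto
    finally show ?thesis by (simp add: algebra_simps power4_eq_xxxx power2_eq_square)
  qed
  have "(\<lambda>n. (norm (?d n))\<^sup>2) \<longlonglongrightarrow> 0"
  proof (rule tendsto_sandwich[OF _ _ tendsto_const])
    show "(\<lambda>n. m\<^sup>2 * (m\<^sup>2 - (norm (blinfun_apply T (x n)))\<^sup>2)) \<longlonglongrightarrow> 0"
      by (rule tendsto_eq_intros lim refl | simp)+
  qed (use d_le in auto)
  from tendsto_real_sqrt[OF this] have d0: "?d \<longlonglongrightarrow> 0"
    by (simp add: tendsto_norm_zero_iff)
  obtain r where r: "strict_mono (r :: nat \<Rightarrow> nat)"
      and "convergent (\<lambda>n. blinfun_apply T (x (r n)))"
    using cpt x1 unfolding compact_op_iff_convergent_subseq by blast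
  then obtain z where z: "(\<lambda>n. blinfun_apply T (x (r n))) \<longlonglongrightarrow> z"
    by (auto simp: convergent_def)
  \<comment> \<open>\<open>m\<^sup>2 x\<close> and \<open>T\<^sup>2 x\<close> have the same limit along the subsequence, so \<open>x\<close> itself converges to \<open>y\<close>.\<close>
  define y where "y = blinfun_apply T z /\<^sub>R m\<^sup>2"
  have Tz: "(\<lambda>n. blinfun_apply T (blinfun_apply T (x (r n)))) \<longlonglongrightarrow> blinfun_apply T z"
    by (intro tendsto_intros z)
  from tendsto_diff[OF this LIMSEQ_subseq_LIMSEQ[OF d0 r, unfolded o_def]]
  have "(\<lambda>n. m\<^sup>2 *\<^sub>R x (r n)) \<longlonglongrightarrow> blinfun_apply T z" by simp
  from tendsto_scaleR[OF tendsto_const[of "inverse (m\<^sup>2)"] this] have y: "(\<lambda>n. x (r n)) \<longlonglongrightarrow> y"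
    using \<open>m > 0\<close> by (simp add: y_def)
  have "y \<in> W"
    using closed_sequentially[OF W(2) _ y] xW by blast
  have Ty: "(\<lambda>n. blinfun_apply T (x (r n))) \<longlonglongrightarrow> blinfun_apply T y"
    by (intro tendsto_intros y)
  then have "z = blinfun_apply T y" by (rule LIMSEQ_unique[OF z])
  then have TTy: "blinfun_apply T (blinfun_apply T y) = m\<^sup>2 *\<^sub>R y"
    using \<open>m > 0\<close> by (simp add: y_def)
  \<comment> \<open>No norm is lost in the limit, which keeps \<open>y\<close> away from zero.\<close>
  have "norm (blinfun_apply T y) = m"
    using LIMSEQ_unique[OF tendsto_norm[OF Ty]] LIMSEQ_subseq_LIMSEQ[OF lim r]
    by (simp add: o_def)
  then have "y \<noteq> 0" using \<open>m > 0\<close> by auto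
  define u where "u = blinfun_apply T y + m *\<^sub>R y"
  show ?thesis
  proof (cases "u = 0")
    case True
    then have "blinfun_apply T y = (- m) *\<^sub>R y"
      by (simp add: u_def eq_neg_iff_add_eq_0)
    then show ?thesis using \<open>y \<in> W\<close> \<open>y \<noteq> 0\<close> by blast
  next
    case False
    have "blinfun_apply T u = m *\<^sub>R u"
      by (simp add: u_def blinfun.add_right blinfun.scaleR_right TTy scaleR_add_right power2_eq_square)
    moreover have "u \<in> W"
      unfolding u_def using \<open>y \<in> W\<close> inv W(1) by (intro subspace_add subspace_scale)
    ultimately show ?thesis using False by blast
  qed
qed

text \<open>A maximal orthonormal set of eigenvectors is a basis: its orthogonal complement is
  invariant because \<open>T\<close> is self-adjoint, so if it were non-zero it would contain one more eigenvector.\<close>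

lemma compact_self_adjoint_eigenbasis:
  fixes T :: "'a::{real_inner,banach} \<Rightarrow>\<^sub>L 'a"
  assumes sa: "blinfun_adjoint T = T" and cpt: "compact_op T"
  obtains E c where "orthonormal_basis E" "\<And>e. e \<in> E \<Longrightarrow> blinfun_apply T e = c e *\<^sub>R e"
proof -
  define Q where "Q = {B. orthonormal B \<and> (\<forall>e\<in>B. \<exists>\<mu>. blinfun_apply T e = \<mu> *\<^sub>R e)}"
  have "\<exists>E\<in>Q. \<forall>X\<in>Q. E \<subseteq> X \<longrightarrow> X = E"
  proof (rule subset_Zorn')
    fix \<C> assume C: "subset.chain Q \<C>"
    have 1: "B \<in> Q" if "B \<in> \<C>" for B
      using C that by (auto simp: subset.chain_def)
    have "orthogonal x y" if xy: "x \<in> \<Union>\<C>" "y \<in> \<Union>\<C>" "x \<noteq> y" for x y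
    proof -
      obtain A B where AB: "A \<in> \<C>" "x \<in> A" "B \<in> \<C>" "y \<in> B" using xy by auto
      then have "A \<subseteq> B \<or> B \<subseteq> A"
        using C by (auto simp: subset_chain_def)
      then show ?thesis
        using AB 1[of A] 1[of B] xy(3) by (auto simp: Q_def orthonormal_def pairwise_def)
    qed
    then show "\<Union>\<C> \<in> Q"
      using 1 by (auto simp: Q_def orthonormal_def pairwise_def)
  qed
  then obtain E where E: "E \<in> Q" and max: "\<And>X. X \<in> Q \<Longrightarrow> E \<subseteq> X \<Longrightarrow> X = E"
    by auto
  have on: "orthonormal E" using E by (simp add: Q_def)
  have "\<forall>e\<in>E. \<exists>\<mu>. blinfun_apply T e = \<mu> *\<^sub>R e"
    using E by (simp add: Q_def)
  from bchoice[OF this] obtain c where c: "\<And>e. e \<in> E \<Longrightarrow> blinfun_apply T e = c e *\<^sub>R e"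
    by blast
  define W where "W = {x. \<forall>e\<in>E. x \<bullet> e = 0}"
  have "subspace W"
    by (auto simp: W_def subspace_def inner_add_left)
  moreover have "closed W"
  proof -
    have "W = (\<Inter>e\<in>E. {x. e \<bullet> x = 0})" by (auto simp: W_def inner_commute)
    then show ?thesis by (auto intro: closed_hyperplane)
  qed
  moreover have "blinfun_apply T x \<in> W" if "x \<in> W" for x
    using that by (simp add: W_def self_adjoint_inner[OF sa] c)
  moreover have "\<not> (\<exists>v \<mu>. v \<in> W \<and> v \<noteq> 0 \<and> blinfun_apply T v = \<mu> *\<^sub>R v)"
  proof safe
    fix v \<mu> assume v: "v \<in> W" "v \<noteq> 0" "blinfun_apply T v = \<mu> *\<^sub>R v"
    define u where "u = v /\<^sub>R norm v"
    have u: "norm u = 1" "u \<in> W" "blinfun_apply T u = \<mu> *\<^sub>R u"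
      using v by (simp_all add: u_def W_def blinfun.scaleR_right)
    then have "insert u E \<in> Q"
      using E by (auto simp: Q_def W_def orthonormal_def pairwise_insert orthogonal_def inner_commute)
    from max[OF this] have "u \<in> E" by auto
    then have "u \<bullet> u = 0" using u(2) by (simp add: W_def)
    then show False using u(1) by simp
  qed
  ultimately have W0: "W = {0}"
    using compact_self_adjoint_eigenvector[OF sa cpt, of W] by blast
  have "x \<in> closure (span E)" for x
  proof -
    define s where "s = (\<Sum>\<^sub>\<infinity>e\<in>E. (x \<bullet> e) *\<^sub>R e)"
    have "x - s \<in> W"
      using orthonormal_residual[OF on] by (simp add: W_def s_def)
    then have "x = s" using W0 by simp
    have "(\<lambda>e. (x \<bullet> e) *\<^sub>R e) summable_on E"
      by (intro orthonormal_summable bessel_summable on)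
    then have lim: "(sum (\<lambda>e. (x \<bullet> e) *\<^sub>R e) \<longlongrightarrow> s) (finite_subsets_at_top E)"
      unfolding s_def by (rule infsum_tendsto)
    have "s \<in> closure (span E)"
    proof (rule Lim_in_closed_set[OF closed_closure _ finite_subsets_at_top_neq_bot lim])
      show "\<forall>\<^sub>F F in finite_subsets_at_top E. (\<Sum>e\<in>F. (x \<bullet> e) *\<^sub>R e) \<in> closure (span E)"
        by (rule eventually_finite_subsets_at_top_weakI)
          (intro closure_subset[THEN subsetD] span_sum span_scale span_base, auto)
    qed
    with \<open>x = s\<close> show ?thesis by simp
  qed
  then have "orthonormal_basis E"
    using on unfolding orthonormal_basis_def by blast
  then show ?thesis using c by (rule that)
qed

section \<open>Operators that are diagonal in an orthonormal basis\<close>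

lemma blinfun_eq_on_basis:
  fixes A B :: "'a::{real_inner,banach} \<Rightarrow>\<^sub>L 'b::real_normed_vector"
  assumes "orthonormal_basis E" "\<And>e. e \<in> E \<Longrightarrow> blinfun_apply A e = blinfun_apply B e"
  shows "A = B"
proof (rule blinfun_eqI)
  fix x
  have A: "((\<lambda>e. (x \<bullet> e) *\<^sub>R blinfun_apply A e) has_sum blinfun_apply A x) E" for A :: "'a \<Rightarrow>\<^sub>L 'b"
    using has_sum_bounded_linear[OF blinfun.bounded_linear_right[of A] fourier_expansion[OF assms(1), of x]]
    by (simp add: blinfun.scaleR_right)
  show "blinfun_apply A x = blinfun_apply B x"
    using has_sum_unique[OF A[of A]] A[of B] assms(2)
      has_sum_cong[of E "\<lambda>e. (x \<bullet> e) *\<^sub>R blinfun_apply A e" "\<lambda>e. (x \<bullet> e) *\<^sub>R blinfun_apply B e"]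
    by auto
qed

lemma diagonal_inner_has_sum:
  fixes A :: "'a::{real_inner,banach} \<Rightarrow>\<^sub>L 'a"
  assumes "orthonormal_basis E" "\<And>e. e \<in> E \<Longrightarrow> blinfun_apply A e = c e *\<^sub>R e"
  shows "((\<lambda>e. c e * (x \<bullet> e) * (y \<bullet> e)) has_sum (blinfun_apply A x \<bullet> y)) E"
proof -
  have "bounded_linear (\<lambda>z. blinfun_apply A z \<bullet> y)"
    by (intro bounded_linear_inner_left_comp blinfun.bounded_linear_right)
  from has_sum_bounded_linear[OF this fourier_expansion[OF assms(1), of x]]
  show ?thesis
    by (rule has_sum_cong[THEN iffD1, rotated])
      (simp add: blinfun.scaleR_right assms(2) inner_commute mult_ac)
qed

lemma diagonal_self_adjoint:
  fixes A :: "'a::{real_inner,banach} \<Rightarrow>\<^sub>L 'a"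
  assumes "orthonormal_basis E" "\<And>e. e \<in> E \<Longrightarrow> blinfun_apply A e = c e *\<^sub>R e"
  shows "blinfun_adjoint A = A"
proof (rule self_adjointI)
  fix x y
  show "blinfun_apply A x \<bullet> y = x \<bullet> blinfun_apply A y"
    using has_sum_unique[OF diagonal_inner_has_sum[OF assms, of x y]]
      diagonal_inner_has_sum[OF assms, of y x]
    by (simp add: inner_commute mult_ac)
qed

lemma diagonal_nonneg_definite:
  fixes A :: "'a::{real_inner,banach} \<Rightarrow>\<^sub>L 'a"
  assumes "orthonormal_basis E" "\<And>e. e \<in> E \<Longrightarrow> blinfun_apply A e = c e *\<^sub>R e"
    and "\<And>e. e \<in> E \<Longrightarrow> 0 \<le> c e"
  shows "nonneg_definite A"
  unfolding nonneg_definite_def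
proof (intro conjI allI)
  show "blinfun_adjoint A = A" by (rule diagonal_self_adjoint[OF assms(1,2)])
  show "0 \<le> blinfun_apply A x \<bullet> x" for x
    by (rule has_sum_nonneg[OF diagonal_inner_has_sum[OF assms(1,2)]])
      (use assms(3) in \<open>auto simp: mult.assoc\<close>)
qed

text \<open>Boundedness of the multipliers is what makes \<open>\<Sum>e\<in>E. c e \<langle>x, e\<rangle> e\<close> converge, with norm at most
  \<open>\<bar>K\<bar> \<parallel>x\<parallel>\<close> by Parseval's identity.\<close>

lemma diagonal_operator_exists:
  fixes E :: "'a::{real_inner,banach} set"
  assumes E: "orthonormal_basis E" and K: "\<And>e. e \<in> E \<Longrightarrow> \<bar>c e\<bar> \<le> K"
  obtains A where "\<And>e. e \<in> E \<Longrightarrow> blinfun_apply A e = c e *\<^sub>R e"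
proof -
  have on: "orthonormal E" using E by (simp add: orthonormal_basis_def)
  have le: "(c e * (x \<bullet> e))\<^sup>2 \<le> K\<^sup>2 * (x \<bullet> e)\<^sup>2" if "e \<in> E" for x e
    using power_mono[OF K[OF that], of 2] by (simp add: power_mult_distrib mult_right_mono)
  have sq: "(\<lambda>e. (c e * (x \<bullet> e))\<^sup>2) summable_on E" for x
    by (rule summable_on_comparison_test[OF summable_on_cmult_right[OF bessel_summable[OF on, of x], of "K\<^sup>2"]])
      (use le in auto)
  define f where "f x = (\<Sum>\<^sub>\<infinity>e\<in>E. (c e * (x \<bullet> e)) *\<^sub>R e)" for x
  have sm: "(\<lambda>e. (c e * (x \<bullet> e)) *\<^sub>R e) summable_on E" for x
    by (rule orthonormal_summable[OF on sq])
  then have f: "((\<lambda>e. (c e * (x \<bullet> e)) *\<^sub>R e) has_sum f x) E" for x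
    unfolding f_def by (rule has_sum_infsum)
  have f_inner: "f x \<bullet> e = c e * (x \<bullet> e)" if "e \<in> E" for x e
  proof -
    have "((\<lambda>d. (c d * (x \<bullet> d)) * (d \<bullet> e)) has_sum (f x \<bullet> e)) E"
      using has_sum_bounded_linear[OF bounded_linear_inner_left[of e] f[of x]] by simp
    moreover have "((\<lambda>d. (c d * (x \<bullet> d)) * (d \<bullet> e)) has_sum (c e * (x \<bullet> e))) E"
    proof (rule has_sum_cong_neutral[THEN iffD1])
      show "((\<lambda>d. (c d * (x \<bullet> d)) * (d \<bullet> e)) has_sum (c e * (x \<bullet> e))) {e}"
        using that by (intro has_sum_finiteI) (auto simp: orthonormal_inner[OF on])
    qed (use that in \<open>auto simp: orthonormal_inner[OF on]\<close>)
    ultimately show ?thesis by (rule has_sum_unique)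
  qed
  have f_norm: "norm (f x) \<le> norm x * \<bar>K\<bar>" for x
  proof (rule power2_le_imp_le)
    have "(norm (f x))\<^sup>2 \<le> K\<^sup>2 * (norm x)\<^sup>2"
    proof (rule has_sum_mono[OF parseval[OF E] has_sum_cmult_right[OF parseval[OF E]]])
      show "(f x \<bullet> e)\<^sup>2 \<le> K\<^sup>2 * (x \<bullet> e)\<^sup>2" if "e \<in> E" for e
        using le[OF that] f_inner[OF that] by simp
    qed
    then show "(norm (f x))\<^sup>2 \<le> (norm x * \<bar>K\<bar>)\<^sup>2"
      by (simp add: power_mult_distrib mult.commute)
  qed simp
  have "bounded_linear f"
  proof (rule bounded_linear_intro[OF _ _ f_norm])
    show "f (x + y) = f x + f y" for x y
      using infsum_add[OF sm[of x] sm[of y]] by (simp add: f_def algebra_simps)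
    show "f (a *\<^sub>R x) = a *\<^sub>R f x" for a x
      using has_sum_unique[OF f[of "a *\<^sub>R x"]] has_sum_scaleR[OF f[of x], of a]
      by (simp add: mult_ac)
  qed
  moreover have "f e = c e *\<^sub>R e" if "e \<in> E" for e
  proof -
    have "((\<lambda>d. (c d * (e \<bullet> d)) *\<^sub>R d) has_sum (c e *\<^sub>R e)) E"
    proof (rule has_sum_cong_neutral[THEN iffD1])
      show "((\<lambda>d. (c d * (e \<bullet> d)) *\<^sub>R d) has_sum (c e *\<^sub>R e)) {e}"
        using that by (intro has_sum_finiteI) (auto simp: orthonormal_inner[OF on])
    qed (use that in \<open>auto simp: orthonormal_inner[OF on]\<close>)
    then show ?thesis using f has_sum_unique by blast
  qed
  ultimately show ?thesis
    by (intro that[of "Blinfun f"]) (simp add: bounded_linear_Blinfun_apply)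
qed

section \<open>Square roots of compact non-negative definite operators\<close>

text \<open>The difference \<open>T = R - S\<close> is compact, so
  it has an eigenbasis, and \<open>R\<^sup>2 - S\<^sup>2 = (T (R + S) + (R + S) T) / 2\<close>. On a unit eigenvector \<open>e\<close> for \<open>\<mu>\<close> this gives
  \<open>\<langle>(R\<^sup>2 - S\<^sup>2) e, e\<rangle> = \<mu> \<langle>(R + S) e, e\<rangle>\<close>, while \<open>\<bar>\<mu>\<bar> = \<bar>\<langle>R e, e\<rangle> - \<langle>S e, e\<rangle>\<bar> \<le> \<langle>(R + S) e, e\<rangle>\<close>
  because both forms are non-negative.\<close>

lemma diff_eigenbasis_square_bound:
  fixes R S :: "'a::{real_inner,banach} \<Rightarrow>\<^sub>L 'a"
  assumes R: "nonneg_definite R" "compact_op (R o\<^sub>L R)"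
    and S: "nonneg_definite S" "compact_op (S o\<^sub>L S)"
  obtains E where "orthonormal_basis E"
    "\<And>e. e \<in> E \<Longrightarrow> (norm (blinfun_apply (R - S) e))\<^sup>2
      \<le> \<bar>blinfun_apply ((R o\<^sub>L R) - (S o\<^sub>L S)) e \<bullet> e\<bar>"
proof -
  have saR: "blinfun_adjoint R = R" and saS: "blinfun_adjoint S = S"
    using R S by (auto simp: nonneg_definite_def)
  have "compact_op (R - S)"
    using compact_op_if_square_compact[OF saR R(2)] compact_op_if_square_compact[OF saS S(2)]
    by (rule compact_op_diff)
  then obtain E c where E: "orthonormal_basis E"
      and c: "\<And>e. e \<in> E \<Longrightarrow> blinfun_apply (R - S) e = c e *\<^sub>R e"
    by (rule compact_self_adjoint_eigenbasis[OF self_adjoint_diff[OF saR saS]]) blast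
  have "(norm (blinfun_apply (R - S) e))\<^sup>2 \<le> \<bar>blinfun_apply ((R o\<^sub>L R) - (S o\<^sub>L S)) e \<bullet> e\<bar>"
    if e: "e \<in> E" for e
  proof -
    let ?r = "blinfun_apply R e \<bullet> e" and ?s = "blinfun_apply S e \<bullet> e"
    have Re: "blinfun_apply R e = blinfun_apply S e + c e *\<^sub>R e"
      using c[OF e] by (simp add: blinfun.diff_left algebra_simps)
    have ee: "e \<bullet> e = 1"
      using E e by (simp add: orthonormal_basis_def orthonormal_def norm_eq_1)
    have r: "?r = ?s + c e" by (simp add: Re inner_add_left ee)
    have "blinfun_apply ((R o\<^sub>L R) - (S o\<^sub>L S)) e \<bullet> e
        = blinfun_apply R e \<bullet> blinfun_apply R e - blinfun_apply S e \<bullet> blinfun_apply S e"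
      by (simp add: blinfun.diff_left inner_diff_left self_adjoint_inner[OF saR, of "blinfun_apply R e"]
          self_adjoint_inner[OF saS, of "blinfun_apply S e"])
    also have "\<dots> = c e * (?r + ?s)"
      unfolding Re inner_add_left inner_add_right inner_scaleR_left inner_scaleR_right ee
        inner_commute[of e "blinfun_apply S e"]
      by (simp add: algebra_simps)
    finally have D: "blinfun_apply ((R o\<^sub>L R) - (S o\<^sub>L S)) e \<bullet> e = c e * (?r + ?s)" .
    have "0 \<le> ?r" "0 \<le> ?s" using R S by (auto simp: nonneg_definite_def)
    then have "\<bar>c e\<bar> \<le> \<bar>?r + ?s\<bar>" using r by linarith
    then have "\<bar>c e\<bar> * \<bar>c e\<bar> \<le> \<bar>c e\<bar> * \<bar>?r + ?s\<bar>" by (intro mult_left_mono) auto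
    moreover have "(norm (blinfun_apply (R - S) e))\<^sup>2 = \<bar>c e\<bar> * \<bar>c e\<bar>"
      using ee[folded norm_eq_1] by (simp add: c[OF e] power2_eq_square)
    ultimately show ?thesis by (simp add: D abs_mult)
  qed
  with E show ?thesis by (rule that)
qed

text \<open>Two roots of the same operator have \<open>R\<^sup>2 - S\<^sup>2 = 0\<close>, so the previous bound makes their
  difference vanish on a basis.\<close>

lemma nonneg_sqrt_unique:
  assumes "nonneg_definite R" "nonneg_definite S" "R o\<^sub>L R = S o\<^sub>L S" "compact_op (S o\<^sub>L S)"
  shows "R = S"
proof -
  obtain E where E: "orthonormal_basis E"
    "\<And>e. e \<in> E \<Longrightarrow> (norm (blinfun_apply (R - S) e))\<^sup>2
      \<le> \<bar>blinfun_apply ((R o\<^sub>L R) - (S o\<^sub>L S)) e \<bullet> e\<bar>"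
    using diff_eigenbasis_square_bound[of R S] assms by metis
  then have "blinfun_apply (R - S) e = 0" if "e \<in> E" for e
    using E(2)[OF that] unfolding assms(3) by simp
  then have "R - S = 0"
    by (intro blinfun_eq_on_basis[OF E(1)]) simp
  then show ?thesis by simp
qed

lemma op_sqrt_eqI:
  assumes "nonneg_definite R" "R o\<^sub>L R = A" "compact_op A"
  shows "op_sqrt A = R"
  unfolding op_sqrt_def
  by (rule the_equality) (use assms nonneg_sqrt_unique in blast)+

text \<open>The definite description in \<^const>\<open>op_sqrt\<close> denotes the unique root as soon as one exists; the
  operator with the roots of the eigenvalues of \<open>A\<close> in an eigenbasis of \<open>A\<close> is one.\<close>

lemma op_sqrt:
  fixes A :: "'a::{real_inner,banach} \<Rightarrow>\<^sub>L 'a"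
  assumes A: "nonneg_definite A" "compact_op A"
  shows "nonneg_definite (op_sqrt A)" "op_sqrt A o\<^sub>L op_sqrt A = A"
proof -
  have sa: "blinfun_adjoint A = A" using A by (simp add: nonneg_definite_def)
  obtain E c where E: "orthonormal_basis E" and c: "\<And>e. e \<in> E \<Longrightarrow> blinfun_apply A e = c e *\<^sub>R e"
    using compact_self_adjoint_eigenbasis[OF sa A(2)] by blast
  have e1: "norm e = 1" if "e \<in> E" for e
    using E that by (simp add: orthonormal_basis_def orthonormal_def)
  have c0: "0 \<le> c e" if "e \<in> E" for e
  proof -
    have "blinfun_apply A e \<bullet> e = c e"
      using e1[OF that] by (simp add: c[OF that] norm_eq_1)
    then show ?thesis using A(1) unfolding nonneg_definite_def by metis
  qed
  have "\<bar>sqrt (c e)\<bar> \<le> sqrt (norm A)" if "e \<in> E" for e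
    using norm_blinfun[of A e] c0[OF that] by (simp add: c[OF that] e1[OF that])
  then obtain R where R: "\<And>e. e \<in> E \<Longrightarrow> blinfun_apply R e = sqrt (c e) *\<^sub>R e"
    using diagonal_operator_exists[OF E, of "\<lambda>e. sqrt (c e)"] by blast
  have nR: "nonneg_definite R"
    by (rule diagonal_nonneg_definite[OF E R]) (use c0 in auto)
  have RR: "R o\<^sub>L R = A"
    by (rule blinfun_eq_on_basis[OF E]) (use c0 in \<open>auto simp: R c blinfun.scaleR_right\<close>)
  show "nonneg_definite (op_sqrt A)" "op_sqrt A o\<^sub>L op_sqrt A = A"
    using nR RR by (simp_all add: op_sqrt_eqI[OF nR RR A(2)])
qed

text \<open>In an eigenbasis of \<open>D\<close> with eigenvalues \<open>d\<^sub>e\<close>, the absolute value \<open>(D\<^sup>* D)\<^sup>1\<^sup>/\<^sup>2\<close> is diagonal with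
  entries \<open>\<bar>d\<^sub>e\<bar>\<close>, and both forms are sums over the basis.\<close>

lemma op_abs_self_adjoint:
  fixes D :: "'a::{real_inner,banach} \<Rightarrow>\<^sub>L 'a"
  assumes sa: "blinfun_adjoint D = D" and cpt: "compact_op D"
  defines "P \<equiv> op_sqrt (blinfun_adjoint D o\<^sub>L D)"
  shows "nonneg_definite P" "compact_op P" "\<bar>blinfun_apply D x \<bullet> x\<bar> \<le> blinfun_apply P x \<bullet> x"
proof -
  obtain E d where E: "orthonormal_basis E" and d: "\<And>e. e \<in> E \<Longrightarrow> blinfun_apply D e = d e *\<^sub>R e"
    using compact_self_adjoint_eigenbasis[OF sa cpt] by blast
  have "\<bar>\<bar>d e\<bar>\<bar> \<le> norm D" if "e \<in> E" for e
    using norm_blinfun[of D e] E that by (simp add: d orthonormal_basis_def orthonormal_def)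
  then obtain Q where Q: "\<And>e. e \<in> E \<Longrightarrow> blinfun_apply Q e = \<bar>d e\<bar> *\<^sub>R e"
    using diagonal_operator_exists[OF E, of "\<lambda>e. \<bar>d e\<bar>"] by blast
  have nQ: "nonneg_definite Q"
    by (rule diagonal_nonneg_definite[OF E Q]) auto
  have QQ: "Q o\<^sub>L Q = D o\<^sub>L D"
    by (rule blinfun_eq_on_basis[OF E]) (auto simp: Q d blinfun.scaleR_right)
  have cQQ: "compact_op (Q o\<^sub>L Q)"
    unfolding QQ by (rule compact_op_compose[OF cpt])
  have PQ: "P = Q"
    unfolding P_def sa by (rule op_sqrt_eqI[OF nQ QQ]) (use cQQ QQ in simp)
  show "nonneg_definite P" using nQ PQ by simp
  then show "compact_op P"
    unfolding PQ nonneg_definite_def using compact_op_if_square_compact cQQ by blast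
  have Dx: "((\<lambda>e. d e * (x \<bullet> e) * (x \<bullet> e)) has_sum (blinfun_apply D x \<bullet> x)) E"
    by (rule diagonal_inner_has_sum[OF E d])
  have Px: "((\<lambda>e. \<bar>d e\<bar> * (x \<bullet> e) * (x \<bullet> e)) has_sum (blinfun_apply P x \<bullet> x)) E"
    unfolding PQ by (rule diagonal_inner_has_sum[OF E Q])
  have "blinfun_apply D x \<bullet> x \<le> blinfun_apply P x \<bullet> x"
    by (rule has_sum_mono[OF Dx Px]) (simp add: mult.assoc mult_right_mono)
  moreover have "- (blinfun_apply D x \<bullet> x) \<le> blinfun_apply P x \<bullet> x"
  proof (rule has_sum_mono[OF _ Px])
    show "((\<lambda>e. - (d e * (x \<bullet> e) * (x \<bullet> e))) has_sum - (blinfun_apply D x \<bullet> x)) E"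
      using Dx by (simp only: has_sum_uminus minus_minus)
    fix e
    have "(- d e) * ((x \<bullet> e) * (x \<bullet> e)) \<le> \<bar>d e\<bar> * ((x \<bullet> e) * (x \<bullet> e))"
      by (rule mult_right_mono) auto
    then show "- (d e * (x \<bullet> e) * (x \<bullet> e)) \<le> \<bar>d e\<bar> * (x \<bullet> e) * (x \<bullet> e)"
      by (simp add: mult.assoc)
  qed
  ultimately show "\<bar>blinfun_apply D x \<bullet> x\<bar> \<le> blinfun_apply P x \<bullet> x" by linarith
qed

section \<open>The Powers-Stormer inequality\<close>

text \<open>The Hilbert-Schmidt norm can be computed in any orthonormal basis, so \<open>E\<close> may be adapted to
  the operators at hand.\<close>

lemma hs_enorm_mono_basis:
  fixes A B :: "'a::{real_inner,banach} \<Rightarrow>\<^sub>L 'a"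
  assumes E: "orthonormal_basis E"
    and le: "\<And>e. e \<in> E \<Longrightarrow> (norm (blinfun_apply A e))\<^sup>2 \<le> (norm (blinfun_apply B e))\<^sup>2"
  shows "hs_enorm A \<le> hs_enorm B"
proof (cases "hilbert_schmidt B")
  case True
  then have B: "(\<lambda>e. (norm (blinfun_apply B e))\<^sup>2) summable_on E"
    by (simp add: hilbert_schmidt_iff_basis[OF E])
  have A: "(\<lambda>e. (norm (blinfun_apply A e))\<^sup>2) summable_on E"
    by (rule summable_on_comparison_test[OF B]) (use le in auto)
  then have "hilbert_schmidt A" by (simp add: hilbert_schmidt_iff_basis[OF E])
  then have "norm (Abs_hs A) \<le> norm (Abs_hs B)"
    using True by (simp add: norm_hs_op_basis[OF E] Abs_hs_inverse infsum_mono[OF A B le])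
  then show ?thesis
    using True \<open>hilbert_schmidt A\<close> by (simp add: hs_enorm_def ennreal_leI)
qed (simp add: hs_enorm_def)

text \<open>Both sides are compared term by term in the eigenbasis of \<open>\<surd>A - \<surd>B\<close>. With
  \<open>P = \<bar>A - B\<bar>\<close>, every \<open>e\<close> in this basis satisfies \<open>\<bar>\<langle>(A - B) e, e\<rangle>\<bar> \<le> \<langle>P e, e\<rangle> = \<parallel>\<surd>P e\<parallel>\<^sup>2\<close>, and
  the squares \<open>\<parallel>\<surd>P e\<parallel>\<^sup>2\<close> add up to the trace norm of \<open>A - B\<close>.\<close>

theorem powers_stormer:
  fixes A B :: "'a::{real_inner,banach} \<Rightarrow>\<^sub>L 'a"
  assumes A: "nonneg_definite A" "compact_op A" and B: "nonneg_definite B" "compact_op B"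
  shows "(hs_enorm (op_sqrt A - op_sqrt B))\<^sup>2 \<le> trace_norm (A - B)"
proof -
  define P where "P = op_sqrt (blinfun_adjoint (A - B) o\<^sub>L (A - B))"
  have saD: "blinfun_adjoint (A - B) = A - B"
    using A B by (intro self_adjoint_diff) (auto simp: nonneg_definite_def)
  note P = op_abs_self_adjoint[OF saD compact_op_diff[OF A(2) B(2)], folded P_def]
  note Q = op_sqrt[OF P(1,2)]
  obtain E where E: "orthonormal_basis E"
      and bound: "\<And>e. e \<in> E \<Longrightarrow> (norm (blinfun_apply (op_sqrt A - op_sqrt B) e))\<^sup>2
        \<le> \<bar>blinfun_apply (A - B) e \<bullet> e\<bar>"
    by (rule diff_eigenbasis_square_bound[of "op_sqrt A" "op_sqrt B",
          unfolded op_sqrt(2)[OF A] op_sqrt(2)[OF B],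
          OF op_sqrt(1)[OF A] A(2) op_sqrt(1)[OF B] B(2)]) blast
  have "hs_enorm (op_sqrt A - op_sqrt B) \<le> hs_enorm (op_sqrt P)"
  proof (rule hs_enorm_mono_basis[OF E])
    fix e assume "e \<in> E"
    then have "(norm (blinfun_apply (op_sqrt A - op_sqrt B) e))\<^sup>2 \<le> blinfun_apply P e \<bullet> e"
      using bound P(3)[of e] by (meson order_trans)
    also have "\<dots> = blinfun_apply (op_sqrt P o\<^sub>L op_sqrt P) e \<bullet> e"
      by (simp only: Q(2))
    also have "\<dots> = (norm (blinfun_apply (op_sqrt P) e))\<^sup>2"
      using Q(1) by (simp add: nonneg_definite_def self_adjoint_inner power2_norm_eq_inner)
    finally show "(norm (blinfun_apply (op_sqrt A - op_sqrt B) e))\<^sup>2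
      \<le> (norm (blinfun_apply (op_sqrt P) e))\<^sup>2" .
  qed
  then show ?thesis
    unfolding trace_norm_def P_def by (intro power_mono) auto
qed

text \<open>The two square-root processes are compared at each fixed time and outcome, where
  \<open>powers_stormer\<close> applies because trace class operators are compact.\<close>

theorem proposition8:
  fixes M :: "'w measure" and rate :: real and N :: "real \<Rightarrow> 'w \<Rightarrow> nat"
    and X :: "nat \<Rightarrow> 'w \<Rightarrow> 'h::{real_inner,banach,second_countable_topology} hs_op"
    and X' :: "nat \<Rightarrow> nat \<Rightarrow> 'w \<Rightarrow> 'h hs_op"
    and C :: "'h hs_op \<Rightarrow>\<^sub>L 'h hs_op" and C' :: "nat \<Rightarrow> 'h hs_op \<Rightarrow>\<^sub>L 'h hs_op"
    and V0 :: "'w \<Rightarrow> 'h hs_op" and V0' :: "nat \<Rightarrow> 'w \<Rightarrow> 'h hs_op"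
    and V :: "real \<Rightarrow> 'w \<Rightarrow> 'h hs_op" and V' :: "nat \<Rightarrow> real \<Rightarrow> 'w \<Rightarrow> 'h hs_op"
    and n :: nat and T :: real
  assumes "compound_poisson_process M rate N X"
    and "\<And>k. compound_poisson_process M rate N (X' k)"
    and "V0 \<in> borel_measurable M" and "\<And>k. V0' k \<in> borel_measurable M"
    and "AE \<omega> in M. \<forall>t\<ge>0. V t \<omega> = ou_solution C (V0 \<omega>) (\<lambda>s. compound_process N X s \<omega>) t"
    and "\<And>k. AE \<omega> in M. \<forall>t\<ge>0.
      V' k t \<omega> = ou_solution (C' k) (V0' k \<omega>) (\<lambda>s. compound_process N (X' k) s \<omega>) t"
    and "AE \<omega> in M. \<forall>t\<ge>0. nonneg_definite (op_of_hs (V t \<omega>)) \<and> trace_class (op_of_hs (V t \<omega>))"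
    and "\<And>k. AE \<omega> in M. \<forall>t\<ge>0.
      nonneg_definite (op_of_hs (V' k t \<omega>)) \<and> trace_class (op_of_hs (V' k t \<omega>))"
    and "T > 0"
  shows "(\<integral>\<^sup>+\<omega>. (SUP t\<in>{0..T}.
            (hs_enorm (op_sqrt (op_of_hs (V t \<omega>)) - op_sqrt (op_of_hs (V' n t \<omega>))))\<^sup>2) \<partial>M)
      \<le> (\<integral>\<^sup>+\<omega>. (SUP t\<in>{0..T}. trace_norm (op_of_hs (V t \<omega>) - op_of_hs (V' n t \<omega>))) \<partial>M)"
proof (rule nn_integral_mono_AE)
  show "AE \<omega> in M. (SUP t\<in>{0..T}.
      (hs_enorm (op_sqrt (op_of_hs (V t \<omega>)) - op_sqrt (op_of_hs (V' n t \<omega>))))\<^sup>2)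
    \<le> (SUP t\<in>{0..T}. trace_norm (op_of_hs (V t \<omega>) - op_of_hs (V' n t \<omega>)))"
    using assms(7) assms(8)[of n]
  proof eventually_elim
    case (elim \<omega>)
    show ?case
    proof (rule SUP_mono)
      fix t assume t: "t \<in> {0..T}"
      have "(hs_enorm (op_sqrt (op_of_hs (V t \<omega>)) - op_sqrt (op_of_hs (V' n t \<omega>))))\<^sup>2
          \<le> trace_norm (op_of_hs (V t \<omega>) - op_of_hs (V' n t \<omega>))"
        by (rule powers_stormer) (use elim t in \<open>auto simp: trace_class_def\<close>)
      with t show "\<exists>s\<in>{0..T}. (hs_enorm (op_sqrt (op_of_hs (V t \<omega>)) - op_sqrt (op_of_hs (V' n t \<omega>))))\<^sup>2
          \<le> trace_norm (op_of_hs (V s \<omega>) - op_of_hs (V' n s \<omega>))"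
        by blast
    qed
  qed
qed

end
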